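(* Let $J=\mathrm{diag}(1,-1,-1,1)$, let $a\in\mathbb{R}$, $b_1,b_2,b_3\in\mathbb{C}$, and let $$A=\begin{bmatrix} a & b_1 & 0 & 0\\ b_3 & -a & b_2 & 0\\ 0 & b_2 & -a & b_3\\ 0&0&b_1&a\end{bmatrix}.$$ Put $$\Delta=a^2+b_1b_3,\qquad \Delta_\pm=\Delta\mp a\,b_2+\frac{b_2^2}{4},$$ $$M=2a^2-|b_1|^2-|b_3|^2,\qquad M_\pm=M+\frac12|b_2|^2\mp 2a\,\Re(b_2).$$ (a) $C^J(A)$ is the union of two nondegenerate and nonconcentric hyperbolas $\mathcal H_+$ and $\mathcal H_-$ if and only if $$b_2\neq0,\qquad |M_+|<2|\Delta_+|\qquad\text{and}\qquad |M_-|<2|\Delta_-| .$$ In this case, $W^J(A)$ is the pseudo-convex hull of $\mathcal H_+$ and $\mathcal H_-$, where $\mathcal H_+$ (resp. $\mathcal H_-$) has foci $\frac12 b_2\pm\sqrt{\Delta_+}$ (resp. $-\frac12 b_2\pm\sqrt{\Delta_-}$) and non-transverse axis of length $(2|\Delta_+|-M_+)^{1/2}$ (resp. $(2|\Delta_-|-M_-)^{1/2}$). Flat portions on the boundary of $W^J(A)$ may possibly exist, or $W^J(A)$ may degenerate into the whole complex plane. (b) In particular, if $b_2=0$ and $|M|<2|\Delta|$, then $W^J(A)$ is a nondegenerate hyperbolic disc with foci at $\pm\sqrt{\Delta}$ and non-transverse axis of length $(2|\Delta|-M)^{1/2}$.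
   Context: For a real diagonal matrix $J\in M_n(\mathbb{C})$ with diagonal entries $\pm1$, put $[x,y]_J=y^*Jx$ for $x,y\in\mathbb{C}^n$. For $A\in M_n(\mathbb{C})$ the $J$-adjoint is $A^\#=JA^*J$. The Krein space numerical range of $A$ is $W^J(A)=W^J_+(A)\cup(-W^J_-(A))\subset\mathbb{C}$, where $W^J_\pm(A)=\{[Ax,x]_J: x\in\mathbb{C}^n,\ [x,x]_J=\pm1\}$ and $-W^J_-(A)=\{-z: z\in W^J_-(A)\}$. Put $\Re^J(A)=\frac{A+A^\#}{2}$ and $\Im^J(A)=\frac{A-A^\#}{2i}$. The boundary generating curve of $W^J(A)$ is the algebraic curve given in homogeneous line coordinates $(u:v:w)$ by $\det(u\,\Re^J(A)+v\,\Im^J(A)+w\,I_n)=0$, i.e. the curve whose tangent lines are the lines $ux+vy+w=0$ with $(u:v:w)$ satisfying this equation (the dual of the curve defined by this equation). $C^J(A)\subset\mathbb{R}^2\cong\mathbb{C}$ denotes its real part. A factor of the determinant proportional to $\alpha u+\beta v+w$ ($\alpha,\beta\in\mathbb{R}$) contributes the point $\alpha+i\beta$ to $C^J(A)$; an irreducible quadratic factor contributes the corresponding dual conic. The pseudo-convex hull of the curve $C^J(A)$ (here of $\mathcal H_+\cup\mathcal H_-$) is obtained as follows. Points of the curve are written $z=[Ax,x]_J/[x,x]_J$ with generating vectors $x$, $[x,x]_J=\pm1$. For any two points $z_1,z_2$ of the curve with generating vectors $x,y$, take the line segment joining them if $[x,x]_J[y,y]_J>0$, and the two rays $\{tz_1+(1-t)z_2: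 t\le0\text{ or }t\ge1\}$ if $[x,x]_J[y,y]_J<0$. A nondegenerate hyperbola has transverse and non-transverse axes of (full) positive lengths $2\tilde a$, $2\tilde b$, with half the focal distance equal to $(\tilde a^2+\tilde b^2)^{1/2}$. A nondegenerate hyperbolic disc bounded by a nondegenerate hyperbola $\mathcal H$ is the union of $\mathcal H$ and the two open convex regions bounded by its two branches (the regions containing the foci); its foci and axes are those of $\mathcal H$. Two hyperbolas are nonconcentric if their centers differ. A flat portion of the boundary is a nontrivial line segment or half-line contained in it. *)

theory Defs
  imports "HOL-Analysis.Analysis" "HOL-Computational_Algebra.Polynomial"
begin

definition jprod :: "complex^'n^'n \<Rightarrow> complex^'n \<Rightarrow> complex^'n \<Rightarrow> complex" where
  "jprod J x y = (\<Sum>i\<in>UNIV. cnj (y $ i) * (J *v x) $ i)"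

definition conj_transpose :: "complex^'n^'n \<Rightarrow> complex^'n^'n" where
  "conj_transpose A = transpose (map_matrix cnj A)"

definition jadjoint :: "complex^'n^'n \<Rightarrow> complex^'n^'n \<Rightarrow> complex^'n^'n" where
  "jadjoint J A = J ** conj_transpose A ** J"

definition jnum_range_pos :: "complex^'n^'n \<Rightarrow> complex^'n^'n \<Rightarrow> complex set" where
  "jnum_range_pos J A = {jprod J (A *v x) x | x. jprod J x x = 1}"

definition jnum_range_neg :: "complex^'n^'n \<Rightarrow> complex^'n^'n \<Rightarrow> complex set" where
  "jnum_range_neg J A = {jprod J (A *v x) x | x. jprod J x x = - 1}"

definition jnum_range :: "complex^'n^'n \<Rightarrow> complex^'n^'n \<Rightarrow> complex set" where
  "jnum_range J A = jnum_range_pos J A \<union> uminus ` jnum_range_neg J A"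

definition jRe :: "complex^'n^'n \<Rightarrow> complex^'n^'n \<Rightarrow> complex^'n^'n" where
  "jRe J A = map_matrix (\<lambda>z. z / 2) (A + jadjoint J A)"

definition jIm :: "complex^'n^'n \<Rightarrow> complex^'n^'n \<Rightarrow> complex^'n^'n" where
  "jIm J A = map_matrix (\<lambda>z. z / (2 * \<i>)) (A - jadjoint J A)"

text \<open>
  The ring of polynomials in the line coordinates u, v, w is represented as
  \<open>complex poly poly poly\<close>, that is C[u][v][w]: the outermost variable is w,
  the innermost one is u.
\<close>

type_synonym poly3 = "complex poly poly poly"

definition const3 :: "complex \<Rightarrow> poly3" where "const3 c = [:[:[:c:]:]:]"
definition var_u :: poly3 where "var_u = [:[:[:0, 1:]:]:]"
definition var_v :: poly3 where "var_v = [:[:0, 1:]:]"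
definition var_w :: poly3 where "var_w = [:0, 1:]"

definition eval3 :: "poly3 \<Rightarrow> complex \<Rightarrow> complex \<Rightarrow> complex \<Rightarrow> complex" where
  "eval3 f u v w = poly (poly (poly f [:[:w:]:]) [:v:]) u"

definition pderiv_u :: "poly3 \<Rightarrow> poly3" where "pderiv_u f = map_poly (map_poly pderiv) f"
definition pderiv_v :: "poly3 \<Rightarrow> poly3" where "pderiv_v f = map_poly pderiv f"
definition pderiv_w :: "poly3 \<Rightarrow> poly3" where "pderiv_w f = pderiv f"

definition line_poly :: "complex^'n^'n \<Rightarrow> complex^'n^'n \<Rightarrow> poly3" where
  "line_poly J A =
     det (\<chi> i j. var_u * const3 (jRe J A $ i $ j) + var_v * const3 (jIm J A $ i $ j)
                 + var_w * const3 (mat 1 $ i $ j))"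

text \<open>
  The tangent to the projective curve \<open>f = 0\<close> at a smooth point (u:v:w) is the point of the
  dual plane whose homogeneous coordinates are the gradient of f at (u,v,w).  Only the chart
  where the third coordinate l does not vanish is needed, the point being then (x:y:1).
\<close>

definition tangents :: "poly3 \<Rightarrow> (complex \<times> complex) set" where
  "tangents f = {(x, y). \<exists>u v w l. (u, v, w) \<noteq> (0, 0, 0) \<and> eval3 f u v w = 0 \<and> l \<noteq> 0 \<and>
      eval3 (pderiv_u f) u v w = l * x \<and> eval3 (pderiv_v f) u v w = l * y \<and>
      eval3 (pderiv_w f) u v w = l}"

text \<open>
  The dual of a reducible curve is the union of the duals of its irreducible components, the
  multiplicities being irrelevant.  For an irreducible f, the dual of \<open>f = 0\<close> is the Zariski
  closure of the set of its tangents, which coincides with the closure in the usual topology.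
  A factor proportional to \<open>\<alpha>u + \<beta>v + w\<close> has the constant gradient
  \<open>(\<alpha>, \<beta>, 1)\<close> up to a scalar and contributes the point \<open>(\<alpha>, \<beta>)\<close>.
\<close>

definition dual_curve :: "poly3 \<Rightarrow> (complex \<times> complex) set" where
  "dual_curve F = (\<Union>f\<in>{f. irreducible f \<and> f dvd F}. closure (tangents f))"

definition generating_curve :: "complex^'n^'n \<Rightarrow> complex^'n^'n \<Rightarrow> complex set" where
  "generating_curve J A =
     {z. (complex_of_real (Re z), complex_of_real (Im z)) \<in> dual_curve (line_poly J A)}"

definition generates :: "complex^'n^'n \<Rightarrow> complex^'n^'n \<Rightarrow> complex^'n \<Rightarrow> complex \<Rightarrow> bool" where
  "generates J A x z \<longleftrightarrow>
     (jprod J x x = 1 \<or> jprod J x x = - 1) \<and> z = jprod J (A *v x) x / jprod J x x"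

definition outer_rays :: "complex \<Rightarrow> complex \<Rightarrow> complex set" where
  "outer_rays z1 z2 =
     {complex_of_real t * z1 + complex_of_real (1 - t) * z2 | t. t \<le> 0 \<or> 1 \<le> t}"

text \<open>For the vectors under consideration \<open>jprod J x x\<close> is 1 or -1, hence the real parts.\<close>

definition pseudo_convex_hull ::
    "complex^'n^'n \<Rightarrow> complex^'n^'n \<Rightarrow> complex set \<Rightarrow> complex set" where
  "pseudo_convex_hull J A C =
     {p. \<exists>z1\<in>C. \<exists>z2\<in>C. \<exists>x y. generates J A x z1 \<and> generates J A y z2 \<and>
        (Re (jprod J x x) * Re (jprod J y y) > 0 \<and> p \<in> closed_segment z1 z2 \<or>
         Re (jprod J x x) * Re (jprod J y y) < 0 \<and> p \<in> outer_rays z1 z2)}"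

text \<open>
  \<open>nondegenerate_hyperbola f g p q H\<close>: H is the hyperbola with foci f and g and with
  transverse and non-transverse axes of full lengths p and q.
\<close>

definition nondegenerate_hyperbola ::
    "complex \<Rightarrow> complex \<Rightarrow> real \<Rightarrow> real \<Rightarrow> complex set \<Rightarrow> bool" where
  "nondegenerate_hyperbola f g p q H \<longleftrightarrow>
     p > 0 \<and> q > 0 \<and> dist f g / 2 = sqrt ((p / 2)\<^sup>2 + (q / 2)\<^sup>2) \<and>
     H = {z. \<bar>dist z f - dist z g\<bar> = p}"

definition nonconcentric_hyperbolas :: "complex set \<Rightarrow> complex set \<Rightarrow> bool" where
  "nonconcentric_hyperbolas H K \<longleftrightarrow>
     (\<exists>f g p q f' g' p' q'. nondegenerate_hyperbola f g p q H \<and>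
        nondegenerate_hyperbola f' g' p' q' K \<and> midpoint f g \<noteq> midpoint f' g')"

text \<open>
  \<open>nondegenerate_hyperbolic_disc f g p q D\<close>: D consists of a hyperbola H as above and of the
  two components of its complement that contain the foci.
\<close>

definition nondegenerate_hyperbolic_disc ::
    "complex \<Rightarrow> complex \<Rightarrow> real \<Rightarrow> real \<Rightarrow> complex set \<Rightarrow> bool" where
  "nondegenerate_hyperbolic_disc f g p q D \<longleftrightarrow>
     (\<exists>H. nondegenerate_hyperbola f g p q H \<and>
        D = H \<union> connected_component_set (- H) f \<union> connected_component_set (- H) g)"

definition has_flat_portion :: "complex set \<Rightarrow> bool" where
  "has_flat_portion S \<longleftrightarrow>
     (\<exists>p q. p \<noteq> q \<and> closed_segment p q \<subseteq> frontier S) \<or>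
     (\<exists>p d. d \<noteq> 0 \<and> {p + complex_of_real t * d | t. t \<ge> 0} \<subseteq> frontier S)"

definition J4 :: "complex^4^4" where
  "J4 = vector [vector [1,  0,  0, 0],
                vector [0, -1,  0, 0],
                vector [0,  0, -1, 0],
                vector [0,  0,  0, 1]]"

definition A4 :: "real \<Rightarrow> complex \<Rightarrow> complex \<Rightarrow> complex \<Rightarrow> complex^4^4" where
  "A4 a b1 b2 b3 =
     vector [vector [complex_of_real a, b1, 0, 0],
             vector [b3, - complex_of_real a, b2, 0],
             vector [0, b2, - complex_of_real a, b3],
             vector [0, 0, b1, complex_of_real a]]"

definition Delta :: "real \<Rightarrow> complex \<Rightarrow> complex \<Rightarrow> complex" where
  "Delta a b1 b3 = (complex_of_real a)\<^sup>2 + b1 * b3"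

definition Delta_plus :: "real \<Rightarrow> complex \<Rightarrow> complex \<Rightarrow> complex \<Rightarrow> complex" where
  "Delta_plus a b1 b2 b3 = Delta a b1 b3 - complex_of_real a * b2 + b2\<^sup>2 / 4"

definition Delta_minus :: "real \<Rightarrow> complex \<Rightarrow> complex \<Rightarrow> complex \<Rightarrow> complex" where
  "Delta_minus a b1 b2 b3 = Delta a b1 b3 + complex_of_real a * b2 + b2\<^sup>2 / 4"

definition M :: "real \<Rightarrow> complex \<Rightarrow> complex \<Rightarrow> real" where
  "M a b1 b3 = 2 * a\<^sup>2 - (cmod b1)\<^sup>2 - (cmod b3)\<^sup>2"

definition M_plus :: "real \<Rightarrow> complex \<Rightarrow> complex \<Rightarrow> complex \<Rightarrow> real" where
  "M_plus a b1 b2 b3 = M a b1 b3 + (cmod b2)\<^sup>2 / 2 - 2 * a * Re b2"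

definition M_minus :: "real \<Rightarrow> complex \<Rightarrow> complex \<Rightarrow> complex \<Rightarrow> real" where
  "M_minus a b1 b2 b3 = M a b1 b3 + (cmod b2)\<^sup>2 / 2 + 2 * a * Re b2"

end

(*
  Exchanging the indices 1 <-> 4 and 2 <-> 3 commutes with J and A, so the quartic form defining the
  generating curve splits into two quadratic forms w'^2 - q(u,v), where w' = Re(c) u + Im(c) v + w
  with c = +-b2/2, and q has determinant (M^2 - 4|D|^2)/16.  If that is nonzero the factor is irreducible and
  its dual is the conic M|m|^2 - 2 Re(conj(m)^2 D) = (M^2 - 4|D|^2)/4, m = z - c: a hyperbola
  when |M| < 2|D| and without real points when M < -2|D|; otherwise the factor splits and
  contributes finitely many points.  An unbounded piece of a hyperbola determines its centre, which
  gives the equivalence in (a).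

  For the numerical range put P = |x1|^2 + |x4|^2, N = |x2|^2 + |x3|^2,
  Om = 2 (x1 conj x2 + x4 conj x3), d = 2 Re(x2 conj x3).  Both [x,x] and [Ax,x] are linear in
  (P, N, Om, d), whose range is the convex cone |Om|^2 <= 4PN, |d| <= N; this yields that the
  pseudo-convex hull is contained in the range.  The faces d = N and d = -N are the two symmetric
  blocks, and every point of the range lies between points of the two blocks with the same sign.
  The values of one block are the image, under a linear map to the plane, of the solid upper sheet
  S >= 0, S^2 - |Om|^2 >= 1 of a hyperboloid; this image is the convex region bounded by a branch of
  the corresponding hyperbola.
*)
theory Submission
  imports Defs "HOL-Computational_Algebra.Polynomial_Factorial" "HOL-Computational_Algebra.Field_as_Ring"
begin

text \<open>For either sign of [x,x] the generated points form a convex set, and in case (a) this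
  set is the convex hull of one branch of each hyperbola. Segments between branches of equal sign
  therefore exhaust the range, while the rays of the hull have to be shown to stay inside it; they
  do, because data of opposite signs can be added in the same cone. The description of a block is
  deliberately asymmetric: all of its points satisfy the branch inequality, but only the boundary
  branch is realised directly, and interior points are recovered from chords. The forward direction
  of (a) is hampered by its quantification over two bare sets whose union is the curve. They are
  tied neither to the factors nor to particular foci, so only point-set information can be compared:
  far away points of a hyperbola fix its centre, and bounded sets cannot hide them. An elliptic
  factor, which would be bounded without being degenerate, cannot occur, because M <= 2|D| always
  holds.\<close>

section \<open>Hyperbolas\<close>

text \<open>
  The conic with centre c whose foci are the two points \<open>c \<plusminus> \<surd>D\<close>; for \<open>\<bar>m\<bar> < 2 \<bar>D\<bar>\<close> it is the
  hyperbola with squared full axes \<open>2 \<bar>D\<bar> \<plusminus> m\<close>.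
\<close>

definition hyp_locus :: "complex \<Rightarrow> complex \<Rightarrow> real \<Rightarrow> complex set" where
  "hyp_locus c D m = {z. m * (cmod (z - c))\<^sup>2 - 2 * Re ((cnj (z - c))\<^sup>2 * D)
                          = (m\<^sup>2 - 4 * (cmod D)\<^sup>2) / 4}"

text \<open>The focal equation is squared twice, after which \<open>r\<close> and \<open>s\<close>
  enter only through r^2 + s^2 and r^2 s^2, both polynomial in \<open>m\<close> and
  \<open>h\<close>. The second squaring could only add r + s = p, which the triangle inequality
  excludes because p is below the focal distance 2|h|.\<close>

lemma hyperbola_dist_eq_iff:
  fixes m h :: complex
  assumes "p > 0" "p < 2 * cmod h"
  shows "\<bar>cmod (m - h) - cmod (m + h)\<bar> = p \<longleftrightarrow>
    (p\<^sup>2 - 2 * (cmod h)\<^sup>2) * (cmod m)\<^sup>2 - 2 * Re ((cnj m)\<^sup>2 * h\<^sup>2)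
      = ((p\<^sup>2 - 2 * (cmod h)\<^sup>2)\<^sup>2 - 4 * (cmod (h\<^sup>2))\<^sup>2) / 4"
proof -
  define r s where "r = cmod (m - h)" and "s = cmod (m + h)"
  have rs0: "r \<ge> 0" "s \<ge> 0" by (auto simp: r_def s_def)
  have sq: "r\<^sup>2 + s\<^sup>2 = 2 * (cmod m)\<^sup>2 + 2 * (cmod h)\<^sup>2"
    by (simp add: r_def s_def cmod_power2) (simp add: power2_eq_square algebra_simps)
  have pr: "r\<^sup>2 * s\<^sup>2 = ((cmod m)\<^sup>2)\<^sup>2 + ((cmod h)\<^sup>2)\<^sup>2 - 2 * Re ((cnj m)\<^sup>2 * h\<^sup>2)"
    by (simp add: r_def s_def cmod_power2) (simp add: power2_eq_square algebra_simps)
  have diff: "4 * ((p\<^sup>2 - 2 * (cmod h)\<^sup>2) * (cmod m)\<^sup>2 - 2 * Re ((cnj m)\<^sup>2 * h\<^sup>2)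
      - ((p\<^sup>2 - 2 * (cmod h)\<^sup>2)\<^sup>2 - 4 * (cmod (h\<^sup>2))\<^sup>2) / 4)
    = 4 * (((cmod m)\<^sup>2)\<^sup>2 + ((cmod h)\<^sup>2)\<^sup>2 - 2 * Re ((cnj m)\<^sup>2 * h\<^sup>2))
      - (2 * (cmod m)\<^sup>2 + 2 * (cmod h)\<^sup>2 - p\<^sup>2)\<^sup>2"
    unfolding norm_power by algebra
  have tri: "r + s > p"
  proof -
    have "cmod (2 * h) = cmod ((m + h) - (m - h))" by (simp add: algebra_simps)
    also have "\<dots> \<le> s + r" unfolding r_def s_def by (rule norm_triangle_ineq4)
    finally show ?thesis using assms by (simp add: norm_mult)
  qed
  have "\<bar>r - s\<bar> = p \<longleftrightarrow> (r - s)\<^sup>2 = p\<^sup>2"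
    using assms(1) power2_eq_iff_nonneg[of "\<bar>r - s\<bar>" p] by simp
  also have "\<dots> \<longleftrightarrow> r\<^sup>2 + s\<^sup>2 - p\<^sup>2 = 2 * (r * s)" by (auto simp: power2_eq_square algebra_simps)
  also have "\<dots> \<longleftrightarrow> (r\<^sup>2 + s\<^sup>2 - p\<^sup>2)\<^sup>2 = (2 * (r * s))\<^sup>2"
  proof
    assume "(r\<^sup>2 + s\<^sup>2 - p\<^sup>2)\<^sup>2 = (2 * (r * s))\<^sup>2"
    then consider "r\<^sup>2 + s\<^sup>2 - p\<^sup>2 = 2 * (r * s)" | "r\<^sup>2 + s\<^sup>2 - p\<^sup>2 = - (2 * (r * s))"
      unfolding power2_eq_iff by blast
    then show "r\<^sup>2 + s\<^sup>2 - p\<^sup>2 = 2 * (r * s)"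
    proof cases
      case 2
      then have "(r + s)\<^sup>2 = p\<^sup>2" by (simp add: power2_eq_square algebra_simps)
      moreover have "(r + s)\<^sup>2 > p\<^sup>2" using tri assms(1) by (intro power_strict_mono) auto
      ultimately show ?thesis by simp
    qed
  qed simp
  also have "\<dots> \<longleftrightarrow> (r\<^sup>2 + s\<^sup>2 - p\<^sup>2)\<^sup>2 = 4 * (r\<^sup>2 * s\<^sup>2)" by (simp add: power_mult_distrib)
  also have "\<dots> \<longleftrightarrow> (2 * (cmod m)\<^sup>2 + 2 * (cmod h)\<^sup>2 - p\<^sup>2)\<^sup>2
       = 4 * (((cmod m)\<^sup>2)\<^sup>2 + ((cmod h)\<^sup>2)\<^sup>2 - 2 * Re ((cnj m)\<^sup>2 * h\<^sup>2))"
    by (simp only: sq pr)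
  also have "\<dots> \<longleftrightarrow> (p\<^sup>2 - 2 * (cmod h)\<^sup>2) * (cmod m)\<^sup>2 - 2 * Re ((cnj m)\<^sup>2 * h\<^sup>2)
      = ((p\<^sup>2 - 2 * (cmod h)\<^sup>2)\<^sup>2 - 4 * (cmod (h\<^sup>2))\<^sup>2) / 4"
    using diff by argo
  finally show ?thesis by (simp add: r_def s_def)
qed

text \<open>With h half the focal vector and D = h^2, the axes satisfy p^2 + q^2 = 4|D|; together
  with p^2 - q^2 = 2m this makes their squares 2|D| + m and 2|D| - m. Only h^2 enters, so the order
  of the foci is immaterial.\<close>

lemma hyperbola_eq_hyp_locus:
  assumes "nondegenerate_hyperbola f g p q H"
  shows "H = hyp_locus (midpoint f g) (((f - g) / 2)\<^sup>2) ((p\<^sup>2 - q\<^sup>2) / 2)"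
    and "\<bar>(p\<^sup>2 - q\<^sup>2) / 2\<bar> < 2 * cmod (((f - g) / 2)\<^sup>2)"
proof -
  define h where "h = (f - g) / 2"
  have pq: "p > 0" "q > 0" and H: "H = {z. \<bar>dist z f - dist z g\<bar> = p}"
    and d: "dist f g / 2 = sqrt ((p / 2)\<^sup>2 + (q / 2)\<^sup>2)"
    using assms by (auto simp: nondegenerate_hyperbola_def)
  have "cmod h = sqrt ((p / 2)\<^sup>2 + (q / 2)\<^sup>2)" using d by (simp add: h_def dist_norm norm_divide)
  then have "(cmod h)\<^sup>2 = (p / 2)\<^sup>2 + (q / 2)\<^sup>2" by simp
  then have h4: "4 * (cmod h)\<^sup>2 = p\<^sup>2 + q\<^sup>2" by (simp add: power_divide)
  have pl: "p < 2 * cmod h"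
  proof (rule power2_less_imp_less)
    show "p\<^sup>2 < (2 * cmod h)\<^sup>2" using h4 pq by (simp add: power_mult_distrib)
  qed simp
  have m: "p\<^sup>2 - 2 * (cmod h)\<^sup>2 = (p\<^sup>2 - q\<^sup>2) / 2" using h4 by argo
  have "z \<in> H \<longleftrightarrow> z \<in> hyp_locus (midpoint f g) (h\<^sup>2) ((p\<^sup>2 - q\<^sup>2) / 2)" for z
  proof -
    have "z - midpoint f g - h = z - f" "z - midpoint f g + h = z - g"
      by (simp_all add: h_def midpoint_def scaleR_conv_of_real field_simps)
    then show ?thesis
      using hyperbola_dist_eq_iff[OF pq(1) pl, of "z - midpoint f g"] unfolding m
      by (simp only: H hyp_locus_def dist_norm mem_Collect_eq)
  qed
  then show "H = hyp_locus (midpoint f g) (((f - g) / 2)\<^sup>2) ((p\<^sup>2 - q\<^sup>2) / 2)"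
    unfolding h_def by blast
  show "\<bar>(p\<^sup>2 - q\<^sup>2) / 2\<bar> < 2 * cmod (((f - g) / 2)\<^sup>2)"
    using h4 zero_less_power[OF pq(1), of 2] zero_less_power[OF pq(2), of 2]
    by (simp add: norm_power abs_less_iff flip: h_def)
qed

lemma nondegenerate_hyperbola_hyp_locus:
  assumes "\<bar>m\<bar> < 2 * cmod D"
  shows "nondegenerate_hyperbola (c + csqrt D) (c - csqrt D)
           (sqrt (2 * cmod D + m)) (sqrt (2 * cmod D - m)) (hyp_locus c D m)"
proof -
  define p q where "p = sqrt (2 * cmod D + m)" and "q = sqrt (2 * cmod D - m)"
  have pq: "p > 0" "q > 0" and p2: "p\<^sup>2 = 2 * cmod D + m" and q2: "q\<^sup>2 = 2 * cmod D - m"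
    using assms by (auto simp: p_def q_def)
  have cm: "(cmod (csqrt D))\<^sup>2 = cmod D" by (simp flip: norm_power)
  have "dist (c + csqrt D) (c - csqrt D) / 2 = cmod (csqrt D)"
    by (simp add: dist_norm norm_mult flip: mult_2)
  also have "\<dots> = sqrt (cmod D)" using real_sqrt_unique[OF cm] by simp
  also have "cmod D = (p / 2)\<^sup>2 + (q / 2)\<^sup>2" by (simp add: power_divide p2 q2 field_simps)
  finally have nh: "nondegenerate_hyperbola (c + csqrt D) (c - csqrt D) p q
      {z. \<bar>dist z (c + csqrt D) - dist z (c - csqrt D)\<bar> = p}"
    using pq by (simp add: nondegenerate_hyperbola_def)
  have "midpoint (c + csqrt D) (c - csqrt D) = c"
    by (simp add: midpoint_def scaleR_conv_of_real)
  moreover have "((c + csqrt D - (c - csqrt D)) / 2)\<^sup>2 = D"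
    by simp
  moreover have "(p\<^sup>2 - q\<^sup>2) / 2 = m" by (simp add: p2 q2)
  ultimately show ?thesis
    using nh hyperbola_eq_hyp_locus(1)[OF nh] by (simp add: p_def q_def)
qed

text \<open>The quadratic form on the left of the equation is at most (m + 2|D|)|v|^2 <= 0, while
  the constant on the right is positive.\<close>

lemma hyp_locus_empty:
  assumes "m < - 2 * cmod D"
  shows "hyp_locus c D m = {}"
proof -
  have False if "z \<in> hyp_locus c D m" for z
  proof -
    define v where "v = z - c"
    have "- 2 * Re ((cnj v)\<^sup>2 * D) \<le> 2 * cmod D * (cmod v)\<^sup>2"
      using abs_Re_le_cmod[of "(cnj v)\<^sup>2 * D"]
      unfolding norm_mult norm_power complex_mod_cnj abs_le_iff mult.commute[of "2 * cmod D"]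
      by linarith
    moreover have "m * (cmod v)\<^sup>2 \<le> (- 2 * cmod D) * (cmod v)\<^sup>2"
      using assms by (intro mult_right_mono) auto
    moreover have "(2 * cmod D)\<^sup>2 < (- m)\<^sup>2"
      using assms by (intro power_strict_mono) auto
    ultimately show False using that by (simp add: hyp_locus_def v_def power_mult_distrib)
  qed
  then show ?thesis by blast
qed

text \<open>
  In the coordinates \<open>z = c + e (X + \<i> Y)\<close> this is \<open>X - A \<surd>(1 + (Y / B)\<^sup>2)\<close>; it vanishes on one
  branch of the hyperbola, is positive on the side of the focus, and \<open>- e\<close> gives the other branch.
\<close>

definition branch_gap :: "complex \<Rightarrow> complex \<Rightarrow> real \<Rightarrow> real \<Rightarrow> complex \<Rightarrow> real" where
  "branch_gap c e A B z =
     Re (cnj e * (z - c)) - A * cmod (Complex 1 (Im (cnj e * (z - c)) / B))"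

lemma branch_gap_line:
  assumes "cmod e = 1"
  shows "branch_gap c e A B (c + e * Complex X Y) = X - A * cmod (Complex 1 (Y / B))"
    and "branch_gap c (- e) A B (c + e * Complex X Y) = - X - A * cmod (Complex 1 (Y / B))"
proof -
  have "cnj e * e = 1" using assms complex_norm_square[of e] by (simp add: mult.commute)
  then have *: "cnj e * (e * w) = w" for w by (simp flip: mult.assoc)
  show "branch_gap c e A B (c + e * Complex X Y) = X - A * cmod (Complex 1 (Y / B))"
    by (simp add: branch_gap_def *)
  show "branch_gap c (- e) A B (c + e * Complex X Y) = - X - A * cmod (Complex 1 (Y / B))"
    by (simp add: branch_gap_def * cmod_def)
qed

lemma unit_coordinates:
  assumes "cmod e = 1"
  obtains X Y where "z = c + e * Complex X Y"
proof -
  have "e * cnj e = 1" using assms complex_norm_square[of e] by simp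
  then have "z = c + e * (cnj e * (z - c))" by (simp flip: mult.assoc)
  then show ?thesis using that[of "Re (cnj e * (z - c))" "Im (cnj e * (z - c))"]
    unfolding complex_surj by blast
qed

text \<open>Multiplication by \<open>cnj e\<close> turns the transverse axis into the real axis: D
  becomes the number |D| and the mixed term disappears.\<close>

lemma hyp_locus_coordinates:
  assumes "cmod e = 1" "D = e\<^sup>2 * of_real (cmod D)"
    and "A\<^sup>2 = (2 * cmod D + m) / 4" "B\<^sup>2 = (2 * cmod D - m) / 4"
  shows "c + e * Complex X Y \<in> hyp_locus c D m \<longleftrightarrow> B\<^sup>2 * X\<^sup>2 - A\<^sup>2 * Y\<^sup>2 = A\<^sup>2 * B\<^sup>2"
proof -
  define w where "w = Complex X Y"
  have e: "cnj e * e = 1" using assms complex_norm_square[of e] by (simp add: mult.commute)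
  have "(cnj (e * w))\<^sup>2 * D = (cnj e * e)\<^sup>2 * (cnj w)\<^sup>2 * of_real (cmod D)"
    by (subst assms(2)) (simp add: power_mult_distrib mult_ac)
  then have "(cnj (e * w))\<^sup>2 * D = (cnj w)\<^sup>2 * of_real (cmod D)"
    by (simp only: e power_one mult_1_left)
  then have "Re ((cnj (e * w))\<^sup>2 * D) = Re ((cnj w)\<^sup>2 * of_real (cmod D))"
    by (rule arg_cong)
  then have "Re ((cnj (e * w))\<^sup>2 * D) = (X\<^sup>2 - Y\<^sup>2) * cmod D"
    by (simp only: w_def) (simp add: power2_eq_square)
  moreover have "(cmod (e * w))\<^sup>2 = X\<^sup>2 + Y\<^sup>2"
    using assms(1) by (simp add: norm_mult w_def cmod_power2)
  ultimately have "c + e * w \<in> hyp_locus c D m \<longleftrightarrow>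
      m * (X\<^sup>2 + Y\<^sup>2) - 2 * ((X\<^sup>2 - Y\<^sup>2) * cmod D) = (m\<^sup>2 - 4 * (cmod D)\<^sup>2) / 4"
    by (simp only: hyp_locus_def mem_Collect_eq add_diff_cancel_left')
  moreover have "4 * (A\<^sup>2 * B\<^sup>2 - (B\<^sup>2 * X\<^sup>2 - A\<^sup>2 * Y\<^sup>2)) =
      m * (X\<^sup>2 + Y\<^sup>2) - 2 * ((X\<^sup>2 - Y\<^sup>2) * cmod D) - (m\<^sup>2 - 4 * (cmod D)\<^sup>2) / 4"
    unfolding assms(3,4) by (simp add: field_simps power2_eq_square)
  ultimately show ?thesis unfolding w_def by argo
qed

lemma hyp_locus_branches:
  assumes "cmod e = 1" "D = e\<^sup>2 * of_real (cmod D)" "A > 0" "B > 0"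
    and "A\<^sup>2 = (2 * cmod D + m) / 4" "B\<^sup>2 = (2 * cmod D - m) / 4"
  shows "hyp_locus c D m = {z. branch_gap c e A B z = 0} \<union> {z. branch_gap c (- e) A B z = 0}"
proof -
  have "z \<in> hyp_locus c D m \<longleftrightarrow> branch_gap c e A B z = 0 \<or> branch_gap c (- e) A B z = 0" for z
  proof -
    obtain X Y where z: "z = c + e * Complex X Y" using unit_coordinates[OF assms(1)] .
    define R where "R = A * cmod (Complex 1 (Y / B))"
    have "R\<^sup>2 = A\<^sup>2 * (1 + (Y / B)\<^sup>2)" by (simp add: R_def power_mult_distrib cmod_power2)
    moreover have "B\<^sup>2 * (Y / B)\<^sup>2 = Y\<^sup>2" using assms(4) by (simp add: power_divide)
    ultimately have "R\<^sup>2 * B\<^sup>2 = A\<^sup>2 * (B\<^sup>2 + Y\<^sup>2)" by algebra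
    then have "z \<in> hyp_locus c D m \<longleftrightarrow> X\<^sup>2 * B\<^sup>2 = R\<^sup>2 * B\<^sup>2"
      unfolding z hyp_locus_coordinates[OF assms(1,2,5,6)] by argo
    also have "\<dots> \<longleftrightarrow> X = R \<or> X = - R" using assms(4) by (simp add: power2_eq_iff)
    finally show ?thesis by (auto simp: z branch_gap_line[OF assms(1)] R_def)
  qed
  then show ?thesis by blast
qed

text \<open>\<open>e\<close> is a square root of the phase of D, hence a direction of the transverse
  axis, and \<open>A\<close>, \<open>B\<close> are the semi-axes. The sign of \<open>e\<close> stays
  open; it only labels the branches.\<close>

lemma hyperbola_axes_exist:
  assumes "\<bar>m\<bar> < 2 * cmod D"
  obtains e A B where "cmod e = 1" "D = e\<^sup>2 * of_real (cmod D)" "A > 0" "B > 0"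
    "A\<^sup>2 = (2 * cmod D + m) / 4" "B\<^sup>2 = (2 * cmod D - m) / 4"
proof
  have D: "D \<noteq> 0" using assms by auto
  let ?e = "csqrt (sgn D)"
  have "(cmod ?e)\<^sup>2 = 1\<^sup>2" using D by (simp add: norm_sgn flip: norm_power)
  then show "cmod ?e = 1" by (rule power2_eq_imp_eq) auto
  show "D = ?e\<^sup>2 * of_real (cmod D)" using D by (simp add: sgn_div_norm scaleR_conv_of_real)
  show "sqrt (2 * cmod D + m) / 2 > 0" "sqrt (2 * cmod D - m) / 2 > 0"
    using assms by auto
  show "(sqrt (2 * cmod D + m) / 2)\<^sup>2 = (2 * cmod D + m) / 4"
     "(sqrt (2 * cmod D - m) / 2)\<^sup>2 = (2 * cmod D - m) / 4"
    using assms by (auto simp: power_divide)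
qed

section \<open>Far points of a hyperbola and its centre\<close>

lemma hyp_locus_far_rectangle:
  assumes "\<bar>m\<bar> < 2 * cmod D"
  obtains e X Y where "cmod e = 1" "X > 0" "Y > 0" "R < cmod (Complex X Y)"
    "\<And>s t. s \<in> {1, - 1} \<Longrightarrow> t \<in> {1, - 1} \<Longrightarrow> c + e * Complex (s * X) (t * Y) \<in> hyp_locus c D m"
proof -
  obtain e A B where e: "cmod e = 1" "D = e\<^sup>2 * of_real (cmod D)" "A > 0" "B > 0"
    "A\<^sup>2 = (2 * cmod D + m) / 4" "B\<^sup>2 = (2 * cmod D - m) / 4"
    using hyperbola_axes_exist[OF assms] .
  \<comment> \<open>Any height above R serves; \<open>\<bar>R\<bar> + 1\<close> also covers negative
    R. \<open>X\<close> is then the abscissa of the branch at height \<open>Y\<close>, and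
    reflection in the two axes gives the other three vertices.\<close>
  define Y where "Y = \<bar>R\<bar> + 1"
  define X where "X = A * sqrt (1 + (Y / B)\<^sup>2)"
  have pos: "Y > 0" "X > 0" using e(3) by (auto simp: Y_def X_def intro!: mult_pos_pos add_pos_nonneg)
  have "X\<^sup>2 = A\<^sup>2 * (1 + (Y / B)\<^sup>2)" by (simp add: X_def power_mult_distrib)
  moreover have "B\<^sup>2 * (Y / B)\<^sup>2 = Y\<^sup>2" using e(4) by (simp add: power_divide)
  ultimately have "B\<^sup>2 * X\<^sup>2 - A\<^sup>2 * Y\<^sup>2 = A\<^sup>2 * B\<^sup>2" by algebra
  then have "c + e * Complex (s * X) (t * Y) \<in> hyp_locus c D m" if "s \<in> {1, - 1}" "t \<in> {1, - 1}" for s t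
    unfolding hyp_locus_coordinates[OF e(1,2,5,6)] using that by auto
  moreover have "R < cmod (Complex X Y)"
    using abs_Im_le_cmod[of "Complex X Y"] by (simp add: Y_def)
  ultimately show ?thesis using that e(1) pos by blast
qed

lemma hyp_locus_unbounded:
  assumes "\<bar>m\<bar> < 2 * cmod D"
  shows "\<not> bounded (hyp_locus c D m)"
proof
  assume "bounded (hyp_locus c D m)"
  then obtain R where R: "\<And>z. z \<in> hyp_locus c D m \<Longrightarrow> cmod z \<le> R"
    unfolding bounded_iff by blast
  obtain e X Y where e: "cmod e = 1" "R + cmod c < cmod (Complex X Y)"
    "\<And>s t. s \<in> {1, - 1} \<Longrightarrow> t \<in> {1, - 1} \<Longrightarrow> c + e * Complex (s * X) (t * Y) \<in> hyp_locus c D m"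
    using hyp_locus_far_rectangle[OF assms, of "R + cmod c" c] by metis
  have "cmod (c + e * Complex X Y) \<le> R" using R[OF e(3)[of 1 1]] by simp
  moreover have "cmod (e * Complex X Y) \<le> cmod (c + e * Complex X Y) + cmod c"
    using norm_triangle_ineq4[of "c + e * Complex X Y" c] by simp
  ultimately show False using e(1,2) by (simp add: norm_mult)
qed

text \<open>Far vertices of a rectangle inscribed in the first hyperbola avoid S, so they lie on the
  second. Two opposite vertices c' + v and c' - v on a conic centred at c force the gradient of its
  quadratic form at d = c' - c to be orthogonal to v. The two diagonals span the plane, so the
  gradient vanishes, and a nondegenerate form permits this only for d = 0.\<close>

lemma hyp_locus_centre_unique:
  assumes h': "\<bar>m'\<bar> < 2 * cmod D'" and h: "\<bar>m\<bar> < 2 * cmod D"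
    and "bounded S" and sub: "hyp_locus c' D' m' \<subseteq> S \<union> hyp_locus c D m"
  shows "c' = c"
proof -
  obtain R where R: "\<And>z. z \<in> S \<Longrightarrow> cmod z \<le> R"
    using assms(3) unfolding bounded_iff by blast
  obtain e X Y where e: "cmod e = 1" "X > 0" "Y > 0" "R + cmod c' < cmod (Complex X Y)"
    "\<And>s t. s \<in> {1, - 1} \<Longrightarrow> t \<in> {1, - 1} \<Longrightarrow> c' + e * Complex (s * X) (t * Y) \<in> hyp_locus c' D' m'"
    using hyp_locus_far_rectangle[OF h', of "R + cmod c'" c'] by metis
  define d where "d = c' - c"
  \<comment> \<open>Half the gradient at \<open>d\<close> of the quadratic form of the second
    hyperbola.\<close>
  define k where "k = of_real m * d - 2 * cnj d * D"
  have mem: "c' + e * Complex (s * X) (t * Y) \<in> hyp_locus c D m"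
    if "s \<in> {1, - 1}" "t \<in> {1, - 1}" for s t
  proof -
    let ?v = "e * Complex (s * X) (t * Y)"
    have "cmod (Complex (s * X) (t * Y)) = cmod (Complex X Y)" using that by (auto simp: cmod_def)
    then have "cmod ?v > R + cmod c'" using e(1,4) by (simp add: norm_mult)
    moreover have "cmod ?v \<le> cmod (c' + ?v) + cmod c'"
      using norm_triangle_ineq4[of "c' + ?v" c'] by simp
    ultimately have "c' + ?v \<notin> S" using R by fastforce
    then show ?thesis using sub e(5)[OF that] by blast
  qed
  have orth: "Re (cnj v * k) = 0" if "c' + v \<in> hyp_locus c D m" "c' - v \<in> hyp_locus c D m" for v
  proof -
    have *: "c' + v - c = d + v" "c' - v - c = d - v" by (simp_all add: d_def)
    have "m * (cmod (d + v))\<^sup>2 - 2 * Re ((cnj (d + v))\<^sup>2 * D) =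
          m * (cmod (d - v))\<^sup>2 - 2 * Re ((cnj (d - v))\<^sup>2 * D)"
      using that unfolding hyp_locus_def mem_Collect_eq * by argo
    then show ?thesis unfolding k_def
      by (simp add: cmod_power2) (simp add: power2_eq_square algebra_simps)
  qed
  have r: "Re (cnj (e * Complex X (t * Y)) * k) = 0" if t: "t \<in> {1, - 1}" for t
  proof (rule orth)
    show "c' + e * Complex X (t * Y) \<in> hyp_locus c D m" using mem[of 1 t] t by simp
    have eq: "c' - e * Complex X (t * Y) = c' + e * Complex (- 1 * X) (- t * Y)"
      by (simp add: complex_eq_iff algebra_simps)
    show "c' - e * Complex X (t * Y) \<in> hyp_locus c D m"
      unfolding eq using t by (intro mem) auto
  qed
  define l where "l = cnj e * k"
  have ex: "cnj (e * Complex X (t * Y)) * k = cnj (Complex X (t * Y)) * l" for t by (simp add: l_def)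
  have "X * Re l + Y * Im l = 0" "X * Re l - Y * Im l = 0"
    using r[of 1] r[of "- 1"] unfolding ex by auto
  then have "X * Re l = 0" "Y * Im l = 0" by linarith+
  then have "l = 0" using e by (simp add: complex_eq_iff)
  then have "k = 0" using e(1) by (auto simp: l_def)
  then have "of_real m * d = 2 * cnj d * D" by (simp add: k_def)
  then have "cmod (of_real m * d) = cmod (2 * cnj d * D)" by simp
  then have "\<bar>m\<bar> * cmod d = (2 * cmod D) * cmod d" by (simp add: norm_mult)
  then show ?thesis using h by (simp add: d_def)
qed

section \<open>Duals of conics\<close>

definition line_linear :: "complex \<Rightarrow> complex \<Rightarrow> poly3" where
  "line_linear \<alpha> \<beta> = [:[:[:0, \<alpha>:], [:\<beta>:]:], 1:]"

text \<open>The polynomial \<open>(w + c1 u + c2 v)\<^sup>2 - (al u\<^sup>2 + 2 be u v + ga v\<^sup>2)\<close>.\<close>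

definition line_quadratic :: "complex \<Rightarrow> complex \<Rightarrow> complex \<Rightarrow> complex \<Rightarrow> complex \<Rightarrow> poly3" where
  "line_quadratic c1 c2 al be ga =
     [:[:[:0, 0, c1\<^sup>2 - al:], [:0, 2 * (c1 * c2 - be):], [:c2\<^sup>2 - ga:]:],
       [:[:0, 2 * c1:], [:2 * c2:]:], 1:]"

lemma eval3_line_linear:
  "eval3 (line_linear \<alpha> \<beta>) u v w = w + \<alpha> * u + \<beta> * v"
  "eval3 (pderiv_u (line_linear \<alpha> \<beta>)) u v w = \<alpha>"
  "eval3 (pderiv_v (line_linear \<alpha> \<beta>)) u v w = \<beta>"
  "eval3 (pderiv_w (line_linear \<alpha> \<beta>)) u v w = 1"
  by (simp_all add: line_linear_def eval3_def pderiv_u_def pderiv_v_def pderiv_w_def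
      map_poly_pCons map_poly_1 pderiv_pCons)

lemma eval3_line_quadratic:
  fixes c1 c2 al be ga u v w :: complex
  defines "F \<equiv> line_quadratic c1 c2 al be ga" and "W \<equiv> w + c1 * u + c2 * v"
  shows "eval3 F u v w = W\<^sup>2 - (al * u\<^sup>2 + 2 * be * u * v + ga * v\<^sup>2)"
    and "eval3 (pderiv_u F) u v w = 2 * (W * c1 - (al * u + be * v))"
    and "eval3 (pderiv_v F) u v w = 2 * (W * c2 - (be * u + ga * v))"
    and "eval3 (pderiv_w F) u v w = 2 * W"
  by (simp_all add: F_def W_def line_quadratic_def eval3_def pderiv_u_def pderiv_v_def pderiv_w_def
      map_poly_pCons map_poly_1 pderiv_pCons)
    (auto simp: power2_eq_square algebra_simps)

lemma tangents_line_linear: "tangents (line_linear \<alpha> \<beta>) = {(\<alpha>, \<beta>)}"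
proof -
  have "\<exists>u v w. (u, v, w) \<noteq> (0, 0, 0) \<and> w + \<alpha> * u + \<beta> * v = 0"
    by (rule exI[of _ 1], rule exI[of _ 0], rule exI[of _ "- \<alpha>"]) simp
  then show ?thesis by (auto simp: tangents_def eval3_line_linear)
qed

text \<open>Up to a factor 2 the gradient is (W c - Q(u,v), W), where Q is the symmetric matrix of
  the quadratic part. A tangent point therefore differs from the centre by -Q(u,v)/W, and W^2 =
  q(u,v) becomes the equation of the conic given by the adjugate of Q.\<close>

lemma tangents_line_quadratic:
  assumes "al * ga \<noteq> be\<^sup>2"
  shows "tangents (line_quadratic c1 c2 al be ga) =
    {(x, y). ga * (x - c1)\<^sup>2 - 2 * be * (x - c1) * (y - c2) + al * (y - c2)\<^sup>2 = al * ga - be\<^sup>2}"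
    (is "?T = ?C")
proof (rule set_eqI, clarify)
  fix x y
  show "(x, y) \<in> ?T \<longleftrightarrow> (x, y) \<in> ?C"
  proof
    assume "(x, y) \<in> ?T"
    then obtain u v w l where l: "l \<noteq> 0" "2 * (w + c1 * u + c2 * v) = l"
      and eq: "(w + c1 * u + c2 * v)\<^sup>2 - (al * u\<^sup>2 + 2 * be * u * v + ga * v\<^sup>2) = 0"
        "2 * ((w + c1 * u + c2 * v) * c1 - (al * u + be * v)) = l * x"
        "2 * ((w + c1 * u + c2 * v) * c2 - (be * u + ga * v)) = l * y"
      unfolding tangents_def mem_Collect_eq case_prod_conv eval3_line_quadratic by blast
    define W where "W = w + c1 * u + c2 * v"
    have W0: "W \<noteq> 0" using l(1) unfolding l(2)[symmetric] W_def[symmetric] by simp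
    have eq: "W\<^sup>2 = al * u\<^sup>2 + 2 * be * u * v + ga * v\<^sup>2"
        "2 * (W * c1 - (al * u + be * v)) = 2 * W * x"
        "2 * (W * c2 - (be * u + ga * v)) = 2 * W * y"
      using eq unfolding l(2)[symmetric] W_def[symmetric] by simp_all
    have "W * (x - c1) = - (al * u + be * v)" "W * (y - c2) = - (be * u + ga * v)"
      using eq(2,3) by algebra+
    then have "W\<^sup>2 * (ga * (x - c1)\<^sup>2 - 2 * be * (x - c1) * (y - c2) + al * (y - c2)\<^sup>2)
        = (al * ga - be\<^sup>2) * (al * u\<^sup>2 + 2 * be * u * v + ga * v\<^sup>2)"
      by algebra
    then show "(x, y) \<in> ?C" using W0 by (simp flip: eq(1))
  next
    assume "(x, y) \<in> ?C"
    then have C: "ga * (x - c1)\<^sup>2 - 2 * be * (x - c1) * (y - c2) + al * (y - c2)\<^sup>2 = al * ga - be\<^sup>2"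
      by simp
    \<comment> \<open>(u, v) is the adjugate of Q applied to the point minus the centre, so that
      Q(u,v) is det Q times that vector; the choice W = - det Q then makes the gradient proportional
      to (x, y, 1).\<close>
    define W where "W = - (al * ga - be\<^sup>2)"
    define u v where "u = ga * (x - c1) - be * (y - c2)" and "v = al * (y - c2) - be * (x - c1)"
    define w where "w = W - c1 * u - c2 * v"
    have W: "w + c1 * u + c2 * v = W" "W \<noteq> 0" using assms by (auto simp: w_def W_def)
    have "W\<^sup>2 = al * u\<^sup>2 + 2 * be * u * v + ga * v\<^sup>2"
      using C unfolding W_def u_def v_def by algebra
    moreover have "2 * (W * c1 - (al * u + be * v)) = 2 * W * x"
      "2 * (W * c2 - (be * u + ga * v)) = 2 * W * y"
      unfolding W_def u_def v_def by algebra+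
    moreover have "(u, v, w) \<noteq> (0, 0, 0)" using W by auto
    ultimately show "(x, y) \<in> ?T"
      unfolding tangents_def mem_Collect_eq case_prod_conv eval3_line_quadratic
      using W by (intro exI[of _ u] exI[of _ v] exI[of _ w] exI[of _ "2 * W"]) simp
  qed
qed

section \<open>Irreducible factors and duals of products\<close>

lemma is_unit_degree_0:
  fixes f :: "'a::idom_divide poly"
  assumes "degree f = 0" "lead_coeff f * c = 1"
  shows "is_unit f"
proof -
  obtain a where f: "f = [:a:]" using assms(1) by (rule degree_eq_zeroE)
  then have "1 = f * [:c:]" using assms(2) by (simp add: mult.commute)
  then show ?thesis by (rule dvdI)
qed

text \<open>Degree 0 in w does not make a polynomial over C[u][v] a unit; for a factor of a monic
  polynomial it does, as the leading coefficients multiply to 1.\<close>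

lemma irreducible_line_linear: "irreducible (line_linear \<alpha> \<beta>)"
proof (rule irreducibleI)
  have deg: "degree (line_linear \<alpha> \<beta>) = 1" by (simp add: line_linear_def)
  then show "line_linear \<alpha> \<beta> \<noteq> 0" by auto
  show "\<not> is_unit (line_linear \<alpha> \<beta>)" using deg by (auto simp: is_unit_poly_iff)
  fix f g assume eq: "line_linear \<alpha> \<beta> = f * g"
  then have "f \<noteq> 0" "g \<noteq> 0" using deg by auto
  then have "degree f + degree g = 1" using deg eq by (simp add: degree_mult_eq)
  moreover have lc: "lead_coeff f * lead_coeff g = 1"
    using arg_cong[OF eq, of lead_coeff] by (simp add: lead_coeff_mult) (simp add: line_linear_def)
  moreover have "is_unit f" if "degree f = 0"
    using that lc by (rule is_unit_degree_0)
  moreover have "is_unit g" if "degree g = 0"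
    using that lc[unfolded mult.commute[of "lead_coeff f"]] by (rule is_unit_degree_0)
  ultimately show "is_unit f \<or> is_unit g" by arith
qed

text \<open>A proper factorisation has two factors linear in w, and then the discriminant 4q is a
  square in C[u][v], which is impossible when det Q is nonzero.\<close>

lemma irreducible_line_quadratic:
  assumes "al * ga \<noteq> be\<^sup>2"
  shows "irreducible (line_quadratic c1 c2 al be ga)"
proof (rule irreducibleI)
  let ?F = "line_quadratic c1 c2 al be ga"
  have deg: "degree ?F = 2" by (simp add: line_quadratic_def)
  then show "?F \<noteq> 0" by auto
  show "\<not> is_unit ?F" using deg by (auto simp: is_unit_poly_iff)
  fix f g assume eq: "?F = f * g"
  then have "f \<noteq> 0" "g \<noteq> 0" using deg by auto
  then have dd: "degree f + degree g = 2" using deg eq by (simp add: degree_mult_eq)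
  have lc: "lead_coeff f * lead_coeff g = 1"
    using arg_cong[OF eq, of lead_coeff]
    by (simp add: lead_coeff_mult) (simp add: line_quadratic_def numeral_2_eq_2)
  have uf: "is_unit f" if "degree f = 0"
    using that lc by (rule is_unit_degree_0)
  have ug: "is_unit g" if "degree g = 0"
    using that lc[unfolded mult.commute[of "lead_coeff f"]] by (rule is_unit_degree_0)
  have no: False if "degree f = 1" "degree g = 1"
  proof -
    obtain f0 f1 where f: "f = [:f0, f1:]" using degree1_coeffs[OF \<open>degree f = 1\<close>] by blast
    obtain g0 g1 where g: "g = [:g0, g1:]" using degree1_coeffs[OF \<open>degree g = 1\<close>] by blast
    define q :: "complex poly poly" where "q = [:[:0, 0, 4 * al:], [:0, 8 * be:], [:4 * ga:]:]"
    have c: "f0 * g0 = coeff ?F 0" "f0 * g1 + f1 * g0 = coeff ?F 1" "f1 * g1 = coeff ?F 2"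
      unfolding eq f g by (simp_all add: numeral_2_eq_2)
    text \<open>The discriminant of \<open>f * g\<close> in w is a square.\<close>
    have "(f0 * g1 - f1 * g0)\<^sup>2 = (coeff ?F 1)\<^sup>2 - 4 * coeff ?F 0 * coeff ?F 2"
      unfolding c[symmetric] by algebra
    also have "\<dots> = q"
      by (simp add: q_def line_quadratic_def numeral_2_eq_2 numeral_poly power2_eq_square algebra_simps)
    finally obtain r where r: "r\<^sup>2 = q" by blast
    \<comment> \<open>The root has v-degree at most 1, say r0 + r1 v with r0, r1 in C[u]; comparing
      (2 r0 r1)^2 with 4 r0^2 r1^2 gives the contradiction al ga = be^2.\<close>
    have "2 * degree r = degree q" unfolding r[symmetric] by (cases "r = 0") (simp_all add: degree_power_eq)
    moreover have "degree q \<le> 2" by (simp add: q_def)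
    ultimately have "degree r \<le> 1" by simp
    then have r01: "r = [:coeff r 0, coeff r 1:]"
      by (intro poly_eqI) (simp add: coeff_pCons coeff_eq_0 split: nat.split)
    define r0 r1 where "r0 = coeff r 0" and "r1 = coeff r 1"
    have "[:r0, r1:]\<^sup>2 = q" using r r01 by (simp add: r0_def r1_def)
    then have "r0 * r0 = [:0, 0, 4 * al:]" "r0 * r1 + r1 * r0 = [:0, 8 * be:]" "r1 * r1 = [:4 * ga:]"
      by (simp_all add: q_def power2_eq_square)
    moreover have "(r0 * r1 + r1 * r0)\<^sup>2 = 4 * (r0 * r0) * (r1 * r1)" by algebra
    ultimately have "[:0, 8 * be:]\<^sup>2 = 4 * [:0, 0, 4 * al:] * [:4 * ga:]" by simp
    then have "al * ga = be\<^sup>2" by (simp add: power2_eq_square numeral_poly)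
    then show False using assms by simp
  qed
  consider "degree f = 0" | "degree g = 0" | "degree f = 1" "degree g = 1" using dd by linarith
  then show "is_unit f \<or> is_unit g" using uf ug no by cases auto
qed

text \<open>With vanishing determinant q is the square of a linear form, and a difference of two
  squares splits. If \<open>al\<close> is zero, so is \<open>be\<close>.\<close>

lemma line_quadratic_split:
  assumes "al * ga = be\<^sup>2"
  obtains \<alpha> \<beta> \<alpha>' \<beta>' where "line_quadratic c1 c2 al be ga = line_linear \<alpha> \<beta> * line_linear \<alpha>' \<beta>'"
proof -
  obtain p q where pq: "p\<^sup>2 = al" "q\<^sup>2 = ga" "p * q = be"
  proof (cases "al = 0")
    case True
    then show ?thesis using that[of 0 "csqrt ga"] assms by simp
  next
    case False
    then show ?thesis using that[of "csqrt al" "be / csqrt al"] assms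
      by (simp add: power_divide nonzero_divide_eq_eq mult.commute)
  qed
  have "line_quadratic c1 c2 al be ga = line_linear (c1 + p) (c2 + q) * line_linear (c1 - p) (c2 - q)"
    unfolding pq[symmetric] by (simp add: line_quadratic_def line_linear_def)
      (simp add: power2_eq_square algebra_simps)
  then show ?thesis using that by blast
qed

text \<open>A constant factor k is absorbed into the multiplier \<open>l\<close>. One inclusion is
  enough, since the reverse one follows with the inverse of k.\<close>

lemma tangents_const_mult_subset:
  assumes "k \<noteq> 0"
  shows "tangents f \<subseteq> tangents (smult [:[:k:]:] f)"
proof -
  have u: "pderiv_u (smult [:[:k:]:] f) = smult [:[:k:]:] (pderiv_u f)"
    by (intro poly_eqI) (simp add: pderiv_u_def coeff_map_poly pderiv_smult)
  have v: "pderiv_v (smult [:[:k:]:] f) = smult [:[:k:]:] (pderiv_v f)"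
    by (intro poly_eqI) (simp add: pderiv_v_def coeff_map_poly pderiv_smult)
  have w: "pderiv_w (smult [:[:k:]:] f) = smult [:[:k:]:] (pderiv_w f)"
    by (simp add: pderiv_w_def pderiv_smult)
  have e: "eval3 (smult [:[:k:]:] h) u v w = k * eval3 h u v w" for h u v w
    by (simp add: eval3_def)
  show ?thesis
  proof (rule subrelI)
    fix x y assume "(x, y) \<in> tangents f"
    then obtain u' v' w' l where "(u', v', w') \<noteq> (0, 0, 0)" "eval3 f u' v' w' = 0" "l \<noteq> 0"
      "eval3 (pderiv_u f) u' v' w' = l * x" "eval3 (pderiv_v f) u' v' w' = l * y"
      "eval3 (pderiv_w f) u' v' w' = l"
      unfolding tangents_def by blast
    then show "(x, y) \<in> tangents (smult [:[:k:]:] f)"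
      unfolding tangents_def mem_Collect_eq case_prod_conv u v w e
      using assms by (intro exI[of _ u'] exI[of _ v'] exI[of _ w'] exI[of _ "k * l"]) simp
  qed
qed

text \<open>The units of C[u][v][w] are the nonzero constants, so an irreducible divisor of F
  differs from F by a constant factor.\<close>

lemma tangents_irreducible_dvd:
  assumes "irreducible f" "irreducible F" "f dvd F"
  shows "tangents f = tangents F"
proof -
  obtain g where g: "F = f * g" using assms(3) by (auto simp: dvd_def)
  have "is_unit g" using assms g by (meson irreducible_def)
  then obtain k where k: "g = [:[:[:k:]:]:]" "is_unit k" by (auto simp: is_unit_poly_iff)
  have k0: "k \<noteq> 0" using k(2) by auto
  then have F: "F = smult [:[:k:]:] f" using g k(1) by simp
  then have "f = smult [:[:inverse k:]:] F" using k0 by (simp add: pCons_one)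
  then show ?thesis using F k0 tangents_const_mult_subset[of k f]
      tangents_const_mult_subset[of "inverse k" F] by auto
qed

lemma dual_curve_irreducible:
  assumes "irreducible F"
  shows "dual_curve F = closure (tangents F)"
proof -
  have "closure (tangents f) = closure (tangents F)" if "f \<in> {f. irreducible f \<and> f dvd F}" for f
    using tangents_irreducible_dvd[of f F] that assms by simp
  moreover have "F \<in> {f. irreducible f \<and> f dvd F}" using assms by simp
  ultimately show ?thesis unfolding dual_curve_def by blast
qed

text \<open>C[u][v][w] is factorial, so an irreducible divisor of a product divides one of the
  factors.\<close>

lemma dual_curve_mult: "dual_curve (F * G) = dual_curve F \<union> dual_curve G"
proof -
  have "f dvd F * G \<longleftrightarrow> f dvd F \<or> f dvd G" if "irreducible f" for f
    using prime_elem_dvd_mult_iff[OF irreducible_imp_prime_elem[OF that]] .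
  then have "{f :: poly3. irreducible f \<and> f dvd F * G}
      = {f. irreducible f \<and> f dvd F} \<union> {f. irreducible f \<and> f dvd G}"
    by blast
  then show ?thesis unfolding dual_curve_def by blast
qed

text \<open>Closure adds nothing here: the tangent points already form the full zero set of a
  polynomial.\<close>

lemma dual_curve_line_quadratic:
  assumes "al * ga \<noteq> be\<^sup>2"
  shows "dual_curve (line_quadratic c1 c2 al be ga) =
    {(x, y). ga * (x - c1)\<^sup>2 - 2 * be * (x - c1) * (y - c2) + al * (y - c2)\<^sup>2 = al * ga - be\<^sup>2}"
proof -
  have "closed {(x, y). ga * (x - c1)\<^sup>2 - 2 * be * (x - c1) * (y - c2) + al * (y - c2)\<^sup>2 = al * ga - be\<^sup>2}"
    unfolding case_prod_unfold by (intro closed_Collect_eq continuous_intros)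
  then show ?thesis
    by (simp add: dual_curve_irreducible irreducible_line_quadratic tangents_line_quadratic assms)
qed

lemma finite_dual_curve_line_quadratic:
  assumes "al * ga = be\<^sup>2"
  shows "finite (dual_curve (line_quadratic c1 c2 al be ga))"
  by (rule line_quadratic_split[OF assms, of c1 c2])
    (simp add: dual_curve_mult dual_curve_irreducible irreducible_line_linear tangents_line_linear)

section \<open>The generating curve\<close>

lemma vector_4:
  "(vector [x, y, z, t] :: 'a::zero^4) $ 1 = x" "(vector [x, y, z, t] :: 'a::zero^4) $ 2 = y"
  "(vector [x, y, z, t] :: 'a::zero^4) $ 3 = z" "(vector [x, y, z, t] :: 'a::zero^4) $ 4 = t"
  unfolding vector_def by simp_all

text \<open>Reversing the order of the indices commutes with the matrix. On symmetric and
  antisymmetric vectors it acts by the 2 x 2 blocks with rows (p, q) and (r, s + t), respectively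
  (r, s - t), and the two factors are their determinants.\<close>

lemma det_4_block_symmetric:
  fixes X :: "'a::comm_ring_1^4^4"
  assumes "X = vector [vector [p, q, 0, 0], vector [r, s, t, 0], vector [0, t, s, r], vector [0, 0, q, p]]"
  shows "det X = (p * (s + t) - q * r) * (p * (s - t) - q * r)"
proof -
  have f: "finite {2::4, 3, 4}" "1 \<notin> {2::4, 3, 4}" "finite {3::4, 4}" "2 \<notin> {3::4, 4}"
    "finite {4::4}" "3 \<notin> {4::4}" by auto
  have X: "X $ 1 $ 1 = p" "X $ 1 $ 2 = q" "X $ 1 $ 3 = 0" "X $ 1 $ 4 = 0"
    "X $ 2 $ 1 = r" "X $ 2 $ 2 = s" "X $ 2 $ 3 = t" "X $ 2 $ 4 = 0"
    "X $ 3 $ 1 = 0" "X $ 3 $ 2 = t" "X $ 3 $ 3 = s" "X $ 3 $ 4 = r"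
    "X $ 4 $ 1 = 0" "X $ 4 $ 2 = 0" "X $ 4 $ 3 = q" "X $ 4 $ 4 = p"
    by (simp_all add: assms vector_4)
  show ?thesis
    unfolding det_def UNIV_4
    unfolding sum_over_permutations_insert[OF f(1,2)]
    unfolding sum_over_permutations_insert[OF f(3,4)]
    unfolding sum_over_permutations_insert[OF f(5,6)]
    unfolding permutes_sing
    by (simp add: sign_swap_id permutation_swap_id sign_compose permutation_compose sign_id swap_id_eq X)
      (simp add: algebra_simps)
qed

lemma jRe_J4_A4:
  "jRe J4 (A4 a b1 b2 b3) = vector
    [vector [of_real a, (b1 - cnj b3) / 2, 0, 0],
     vector [(b3 - cnj b1) / 2, - of_real a, of_real (Re b2), 0],
     vector [0, of_real (Re b2), - of_real a, (b3 - cnj b1) / 2],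
     vector [0, 0, (b1 - cnj b3) / 2, of_real a]]"
  by (simp add: vec_eq_iff forall_4 jRe_def jadjoint_def conj_transpose_def map_matrix_def
      transpose_def matrix_matrix_mult_def sum_4 J4_def A4_def vector_4 complex_eq_iff)

lemma jIm_J4_A4:
  "jIm J4 (A4 a b1 b2 b3) = vector
    [vector [0, (b1 + cnj b3) / (2 * \<i>), 0, 0],
     vector [(b3 + cnj b1) / (2 * \<i>), 0, of_real (Im b2), 0],
     vector [0, of_real (Im b2), 0, (b3 + cnj b1) / (2 * \<i>)],
     vector [0, 0, (b1 + cnj b3) / (2 * \<i>), 0]]"
  by (simp add: vec_eq_iff forall_4 jIm_def jadjoint_def conj_transpose_def map_matrix_def
      transpose_def matrix_matrix_mult_def sum_4 J4_def A4_def vector_4 complex_eq_iff)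

text \<open>The factor belonging to symmetric vectors; antisymmetric ones give the same polynomial
  with - b2. The matrix Q of its quadratic part has trace \<open>M_plus\<close> / 2, and its
  traceless part is read off from \<open>Delta_plus\<close> / 2.\<close>

definition block_poly :: "real \<Rightarrow> complex \<Rightarrow> complex \<Rightarrow> complex \<Rightarrow> poly3" where
  "block_poly a b1 b2 b3 = line_quadratic (of_real (Re b2 / 2)) (of_real (Im b2 / 2))
     (of_real ((M_plus a b1 b2 b3 + 2 * Re (Delta_plus a b1 b2 b3)) / 4))
     (of_real (Im (Delta_plus a b1 b2 b3) / 2))
     (of_real ((M_plus a b1 b2 b3 - 2 * Re (Delta_plus a b1 b2 b3)) / 4))"

lemma block_poly_eq:
  "block_poly a b1 b2 b3 =
     (var_u * const3 (of_real a) + var_w)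
       * ((var_u * const3 (- of_real a) + var_w)
          + (var_u * const3 (of_real (Re b2)) + var_v * const3 (of_real (Im b2))))
     - (var_u * const3 ((b1 - cnj b3) / 2) + var_v * const3 ((b1 + cnj b3) / (2 * \<i>)))
       * (var_u * const3 ((b3 - cnj b1) / 2) + var_v * const3 ((b3 + cnj b1) / (2 * \<i>)))"
proof -
  have uu: "of_real ((Re b2 / 2)\<^sup>2) - of_real ((M_plus a b1 b2 b3 + 2 * Re (Delta_plus a b1 b2 b3)) / 4)
     = of_real a * (- of_real a + of_real (Re b2)) - (b1 - cnj b3) / 2 * ((b3 - cnj b1) / 2)"
    by (simp add: M_plus_def M_def Delta_plus_def Delta_def cmod_power2 complex_eq_iff)
      (simp add: power2_eq_square field_simps)
  have uv: "2 * (of_real (Re b2 / 2) * of_real (Im b2 / 2) - of_real (Im (Delta_plus a b1 b2 b3) / 2))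
     = of_real a * of_real (Im b2) - (b1 - cnj b3) / 2 * ((b3 + cnj b1) / (2 * \<i>))
        - (b1 + cnj b3) / (2 * \<i>) * ((b3 - cnj b1) / 2)"
    by (simp add: Delta_plus_def Delta_def complex_eq_iff)
      (simp add: power2_eq_square field_simps)
  have vv: "of_real ((Im b2 / 2)\<^sup>2) - of_real ((M_plus a b1 b2 b3 - 2 * Re (Delta_plus a b1 b2 b3)) / 4)
     = - (b1 + cnj b3) / (2 * \<i>) * ((b3 + cnj b1) / (2 * \<i>))"
    by (simp add: M_plus_def M_def Delta_plus_def Delta_def cmod_power2 complex_eq_iff)
      (simp add: power2_eq_square field_simps)
  show ?thesis
    unfolding block_poly_def line_quadratic_def of_real_power[symmetric] uu uv vv
      var_u_def var_v_def var_w_def const3_def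
    by (simp add: algebra_simps)
qed

lemma line_poly_J4_A4:
  "line_poly J4 (A4 a b1 b2 b3) = block_poly a b1 b2 b3 * block_poly a b1 (- b2) b3"
proof -
  let ?p = "var_u * const3 (of_real a) + var_w"
  let ?s = "var_u * const3 (- of_real a) + var_w"
  let ?t = "var_u * const3 (of_real (Re b2)) + var_v * const3 (of_real (Im b2))"
  let ?q = "var_u * const3 ((b1 - cnj b3) / 2) + var_v * const3 ((b1 + cnj b3) / (2 * \<i>))"
  let ?r = "var_u * const3 ((b3 - cnj b1) / 2) + var_v * const3 ((b3 + cnj b1) / (2 * \<i>))"
  have c: "const3 0 = 0" "const3 1 = 1" "const3 (- x) = - const3 x" for x
    by (simp_all add: const3_def one_pCons)
  have "(\<chi> i j. var_u * const3 (jRe J4 (A4 a b1 b2 b3) $ i $ j)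
      + var_v * const3 (jIm J4 (A4 a b1 b2 b3) $ i $ j) + var_w * const3 (mat 1 $ i $ j))
    = vector [vector [?p, ?q, 0, 0], vector [?r, ?s, ?t, 0], vector [0, ?t, ?s, ?r], vector [0, 0, ?q, ?p]]"
    by (simp add: vec_eq_iff forall_4 jRe_J4_A4 jIm_J4_A4 vector_4 mat_def c)
  then have "line_poly J4 (A4 a b1 b2 b3) = (?p * (?s + ?t) - ?q * ?r) * (?p * (?s - ?t) - ?q * ?r)"
    unfolding line_poly_def by (rule det_4_block_symmetric)
  moreover have "block_poly a b1 b2 b3 = ?p * (?s + ?t) - ?q * ?r" by (rule block_poly_eq)
  moreover have "block_poly a b1 (- b2) b3 = ?p * (?s - ?t) - ?q * ?r"
    unfolding block_poly_eq by (simp add: c algebra_simps)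
  ultimately show ?thesis by simp
qed

lemma Delta_minus_eq: "Delta_minus a b1 b2 b3 = Delta_plus a b1 (- b2) b3"
  and M_minus_eq: "M_minus a b1 b2 b3 = M_plus a b1 (- b2) b3"
  by (simp_all add: Delta_minus_def Delta_plus_def M_minus_def M_plus_def)

text \<open>This rules out an ellipse. With \<alpha> = a - b2/2 one has D = \<alpha>^2 + b1 b3 and m
  = 2|\<alpha>|^2 - |b1|^2 - |b3|^2, so the bound is the triangle inequality combined with 2|b1 b3|
  <= |b1|^2 + |b3|^2.\<close>

lemma M_plus_le: "M_plus a b1 b2 b3 \<le> 2 * cmod (Delta_plus a b1 b2 b3)"
proof -
  define \<alpha> where "\<alpha> = of_real a - b2 / 2"
  have "Delta_plus a b1 b2 b3 = \<alpha>\<^sup>2 + b1 * b3"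
    by (simp add: \<alpha>_def Delta_plus_def Delta_def power2_eq_square field_simps)
  then have "cmod (\<alpha>\<^sup>2) \<le> cmod (Delta_plus a b1 b2 b3) + cmod (b1 * b3)"
    using norm_triangle_ineq4[of "\<alpha>\<^sup>2 + b1 * b3" "b1 * b3"] by simp
  moreover have "M_plus a b1 b2 b3 = 2 * (cmod \<alpha>)\<^sup>2 - (cmod b1)\<^sup>2 - (cmod b3)\<^sup>2"
    unfolding M_plus_def M_def \<alpha>_def cmod_power2 by (simp add: power2_eq_square field_simps)
  moreover have "2 * (cmod b1 * cmod b3) \<le> (cmod b1)\<^sup>2 + (cmod b3)\<^sup>2"
    using sum_squares_bound[of "cmod b1" "cmod b3"] by simp
  ultimately show ?thesis by (simp add: norm_mult norm_power)
qed

definition real_points :: "(complex \<times> complex) set \<Rightarrow> complex set" where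
  "real_points S = {z. (of_real (Re z), of_real (Im z)) \<in> S}"

lemma generating_curve_J4_A4:
  "generating_curve J4 (A4 a b1 b2 b3) =
     real_points (dual_curve (block_poly a b1 b2 b3)) \<union> real_points (dual_curve (block_poly a b1 (- b2) b3))"
  by (auto simp: generating_curve_def line_poly_J4_A4 dual_curve_mult real_points_def)

text \<open>Away from |m| = 2|D| the determinant (m^2 - 4|D|^2)/16 of Q is nonzero and the conic
  formula applies; at real points its equation, multiplied by 4, is that of
  \<open>hyp_locus\<close>. The case without real points is included.\<close>

lemma real_points_block_curve:
  fixes a b1 b2 b3
  defines "m \<equiv> M_plus a b1 b2 b3" and "D \<equiv> Delta_plus a b1 b2 b3"
  assumes "\<bar>m\<bar> \<noteq> 2 * cmod D"
  shows "real_points (dual_curve (block_poly a b1 b2 b3)) = hyp_locus (b2 / 2) D m"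
proof -
  have ne: "(2 * cmod D)\<^sup>2 \<noteq> m\<^sup>2"
  proof
    assume "(2 * cmod D)\<^sup>2 = m\<^sup>2"
    then have "2 * cmod D = m \<or> 2 * cmod D = - m" unfolding power2_eq_iff .
    then show False using assms(3) norm_ge_zero[of D] by linarith
  qed
  have det: "(m + 2 * Re D) / 4 * ((m - 2 * Re D) / 4) - (Im D / 2)\<^sup>2 = (m\<^sup>2 - 4 * (cmod D)\<^sup>2) / 16"
    by (simp add: cmod_power2) (simp add: power2_eq_square field_simps)
  then have "(m + 2 * Re D) / 4 * ((m - 2 * Re D) / 4) \<noteq> (Im D / 2)\<^sup>2" using ne by (auto simp: power_mult_distrib)
  then have det': "complex_of_real ((m + 2 * Re D) / 4) * of_real ((m - 2 * Re D) / 4)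
      \<noteq> (of_real (Im D / 2))\<^sup>2"
    by (simp only: of_real_eq_iff flip: of_real_mult of_real_power) simp
  have "z \<in> real_points (dual_curve (block_poly a b1 b2 b3)) \<longleftrightarrow> z \<in> hyp_locus (b2 / 2) D m" for z
  proof -
    define x y where "x = Re z - Re b2 / 2" and "y = Im z - Im b2 / 2"
    have r: "complex_of_real (Re z) - of_real (Re b2 / 2) = of_real x"
      "complex_of_real (Im z) - of_real (Im b2 / 2) = of_real y" by (simp_all add: x_def y_def)
    have "z \<in> real_points (dual_curve (block_poly a b1 b2 b3)) \<longleftrightarrow>
      of_real ((m - 2 * Re D) / 4) * (complex_of_real x)\<^sup>2
        - 2 * of_real (Im D / 2) * of_real x * of_real y + of_real ((m + 2 * Re D) / 4) * (of_real y)\<^sup>2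
      = of_real ((m + 2 * Re D) / 4) * of_real ((m - 2 * Re D) / 4) - (of_real (Im D / 2))\<^sup>2"
      unfolding real_points_def block_poly_def m_def[symmetric] D_def[symmetric]
        dual_curve_line_quadratic[OF det'] mem_Collect_eq case_prod_conv r ..
    also have "\<dots> \<longleftrightarrow> complex_of_real ((m - 2 * Re D) / 4 * x\<^sup>2 - 2 * (Im D / 2) * x * y + (m + 2 * Re D) / 4 * y\<^sup>2)
      = complex_of_real ((m + 2 * Re D) / 4 * ((m - 2 * Re D) / 4) - (Im D / 2)\<^sup>2)"
      by (simp only: of_real_mult of_real_power of_real_add of_real_diff of_real_numeral)
    also have "\<dots> \<longleftrightarrow> (m - 2 * Re D) / 4 * x\<^sup>2 - 2 * (Im D / 2) * x * y + (m + 2 * Re D) / 4 * y\<^sup>2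
      = (m\<^sup>2 - 4 * (cmod D)\<^sup>2) / 16"
      unfolding of_real_eq_iff det ..
    also have "\<dots> \<longleftrightarrow> m * (x\<^sup>2 + y\<^sup>2) - 2 * ((x\<^sup>2 - y\<^sup>2) * Re D + 2 * x * y * Im D) = (m\<^sup>2 - 4 * (cmod D)\<^sup>2) / 4"
      by (auto simp: field_simps)
    also have "\<dots> \<longleftrightarrow> z \<in> hyp_locus (b2 / 2) D m"
    proof -
      have zc: "z - b2 / 2 = Complex x y" by (simp add: x_def y_def complex_eq_iff)
      have "Re ((cnj (Complex x y))\<^sup>2 * D) = (x\<^sup>2 - y\<^sup>2) * Re D + 2 * x * y * Im D"
        by (simp add: power2_eq_square)
      moreover have "(cmod (Complex x y))\<^sup>2 = x\<^sup>2 + y\<^sup>2" by (simp add: cmod_power2)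
      ultimately show ?thesis unfolding hyp_locus_def mem_Collect_eq zc by simp
    qed
    finally show ?thesis .
  qed
  then show ?thesis by blast
qed

text \<open>Either det Q = 0 and the factor contributes finitely many points, or m < -2|D| and it
  contributes none; \<open>M_plus_le\<close> leaves no other case.\<close>

lemma bounded_block_curve:
  assumes "\<not> \<bar>M_plus a b1 b2 b3\<bar> < 2 * cmod (Delta_plus a b1 b2 b3)"
  shows "bounded (real_points (dual_curve (block_poly a b1 b2 b3)))"
proof (cases "\<bar>M_plus a b1 b2 b3\<bar> = 2 * cmod (Delta_plus a b1 b2 b3)")
  case True
  define m D where "m = M_plus a b1 b2 b3" and "D = Delta_plus a b1 b2 b3"
  have "m\<^sup>2 = \<bar>m\<bar>\<^sup>2" by simp
  also have "\<dots> = (2 * cmod D)\<^sup>2" using True unfolding m_def D_def by (rule arg_cong)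
  finally have "m\<^sup>2 = (2 * cmod D)\<^sup>2" .
  then have "(m + 2 * Re D) / 4 * ((m - 2 * Re D) / 4) = (Im D / 2)\<^sup>2"
    unfolding power_mult_distrib cmod_power2 by (simp add: power_divide algebra_simps power2_eq_square)
  then have "complex_of_real ((m + 2 * Re D) / 4) * of_real ((m - 2 * Re D) / 4)
      = (of_real (Im D / 2))\<^sup>2"
    by (simp only: of_real_eq_iff flip: of_real_mult of_real_power)
  then have fin: "finite (dual_curve (block_poly a b1 b2 b3))"
    unfolding block_poly_def m_def D_def by (rule finite_dual_curve_line_quadratic)
  have "real_points S \<subseteq> (\<lambda>(x, y). Complex (Re x) (Re y)) ` S" for S
  proof
    fix z assume "z \<in> real_points S"
    then have "(of_real (Re z), of_real (Im z)) \<in> S" by (simp add: real_points_def)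
    then show "z \<in> (\<lambda>(x, y). Complex (Re x) (Re y)) ` S" by (rule rev_image_eqI) simp
  qed
  then have "finite (real_points (dual_curve (block_poly a b1 b2 b3)))"
    by (rule finite_subset) (rule finite_imageI[OF fin])
  then show ?thesis by (rule finite_imp_bounded)
next
  case False
  then have "M_plus a b1 b2 b3 < - 2 * cmod (Delta_plus a b1 b2 b3)"
    using M_plus_le[of a b1 b2 b3] assms by linarith
  then show ?thesis using real_points_block_curve[OF False] hyp_locus_empty by simp
qed

section \<open>The equivalence in (a)\<close>

lemma generating_curve_hyperbolas:
  assumes "\<bar>M_plus a b1 b2 b3\<bar> < 2 * cmod (Delta_plus a b1 b2 b3)"
    and "\<bar>M_minus a b1 b2 b3\<bar> < 2 * cmod (Delta_minus a b1 b2 b3)"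
  shows "generating_curve J4 (A4 a b1 b2 b3) =
    hyp_locus (b2 / 2) (Delta_plus a b1 b2 b3) (M_plus a b1 b2 b3)
    \<union> hyp_locus (- b2 / 2) (Delta_minus a b1 b2 b3) (M_minus a b1 b2 b3)"
proof -
  have "\<bar>M_plus a b1 b2 b3\<bar> \<noteq> 2 * cmod (Delta_plus a b1 b2 b3)"
    "\<bar>M_plus a b1 (- b2) b3\<bar> \<noteq> 2 * cmod (Delta_plus a b1 (- b2) b3)"
    using assms unfolding Delta_minus_eq M_minus_eq by linarith+
  then show ?thesis
    unfolding Delta_minus_eq M_minus_eq generating_curve_J4_A4
    by (simp add: real_points_block_curve)
qed

text \<open>Two nonconcentric hyperbolas are never covered by \<open>G1\<close> together with a
  bounded set: if \<open>G1\<close> is a hyperbola, both would inherit its centre c. Taking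
  \<open>G2\<close> as the bounded set gives the first claim, taking the empty set the
  second.\<close>

lemma hyperbola_union_imp:
  assumes HK: "nonconcentric_hyperbolas H K" "G1 \<union> G2 = H \<union> K"
    and G1: "bounded G1 \<or> (\<exists>D m. \<bar>m\<bar> < 2 * cmod D \<and> G1 = hyp_locus c D m)"
  shows "\<not> bounded G2" and "G2 \<noteq> G1"
proof -
  obtain f g p q f' g' p' q' where hk: "nondegenerate_hyperbola f g p q H"
    "nondegenerate_hyperbola f' g' p' q' K" "midpoint f g \<noteq> midpoint f' g'"
    using HK(1) unfolding nonconcentric_hyperbolas_def by (elim exE conjE) (rule that)
  note H = hyperbola_eq_hyp_locus[OF hk(1)] and K = hyperbola_eq_hyp_locus[OF hk(2)]
  have False if b: "bounded S" and sub: "H \<union> K \<subseteq> S \<union> G1" for S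
  proof (cases "bounded G1")
    case True
    then have "bounded (S \<union> G1)" using b by simp
    then have "bounded H" by (rule bounded_subset) (use sub in blast)
    then show False using hyp_locus_unbounded[OF H(2), of "midpoint f g", folded H(1)] by simp
  next
    case False
    then obtain D m where D: "\<bar>m\<bar> < 2 * cmod D" "G1 = hyp_locus c D m" using G1 by blast
    have "H \<subseteq> S \<union> hyp_locus c D m" "K \<subseteq> S \<union> hyp_locus c D m"
      using sub unfolding D(2) by simp_all
    then have "midpoint f g = c" "midpoint f' g' = c"
      using hyp_locus_centre_unique[OF H(2) D(1) b, of "midpoint f g" c, folded H(1)]
        hyp_locus_centre_unique[OF K(2) D(1) b, of "midpoint f' g'" c, folded K(1)] by simp_all
    then show False using hk(3) by simp
  qed
  note no = this
  show "\<not> bounded G2" using no[of G2] HK(2) by blast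
  show "G2 \<noteq> G1" using no[of "{}"] HK(2) by auto
qed

lemma midpoint_add_diff: "midpoint (c + s) (c - s) = (c :: complex)"
  by (simp add: midpoint_def scaleR_conv_of_real)

lemma nonconcentric_hyp_locus:
  assumes "b2 \<noteq> 0" "\<bar>m\<bar> < 2 * cmod D" "\<bar>m'\<bar> < 2 * cmod D'"
  shows "nonconcentric_hyperbolas (hyp_locus (b2 / 2) D m) (hyp_locus (- b2 / 2) D' m')"
proof -
  have ne: "midpoint (b2 / 2 + csqrt D) (b2 / 2 - csqrt D)
      \<noteq> midpoint (- b2 / 2 + csqrt D') (- b2 / 2 - csqrt D')"
    unfolding midpoint_add_diff using assms(1) by simp
  show ?thesis
    unfolding nonconcentric_hyperbolas_def
    by (intro exI conjI) (rule nondegenerate_hyperbola_hyp_locus[OF assms(2)]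
        nondegenerate_hyperbola_hyp_locus[OF assms(3)] ne)+
qed

text \<open>From the left-hand side only this is extracted: the real points of either factor are
  unbounded, and the two sets are distinct. Unboundedness leaves just the hyperbolic case, and for
  b2 = 0 the factors would coincide.\<close>

lemma generating_curve_iff:
  "(\<exists>Hp Hm. nonconcentric_hyperbolas Hp Hm \<and> generating_curve J4 (A4 a b1 b2 b3) = Hp \<union> Hm) \<longleftrightarrow>
      b2 \<noteq> 0 \<and>
      \<bar>M_plus a b1 b2 b3\<bar> < 2 * cmod (Delta_plus a b1 b2 b3) \<and>
      \<bar>M_minus a b1 b2 b3\<bar> < 2 * cmod (Delta_minus a b1 b2 b3)"
  (is "?L \<longleftrightarrow> ?R")
proof
  assume ?R
  then show ?L using generating_curve_hyperbolas nonconcentric_hyp_locus by blast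
next
  assume ?L
  then obtain Hp Hm where H: "nonconcentric_hyperbolas Hp Hm" and
    u: "generating_curve J4 (A4 a b1 b2 b3) = Hp \<union> Hm" by blast
  define G where "G b = real_points (dual_curve (block_poly a b1 b b3))" for b
  have G: "bounded (G b) \<or> (\<exists>D m. \<bar>m\<bar> < 2 * cmod D \<and> G b = hyp_locus (b / 2) D m)" for b
  proof (cases "\<bar>M_plus a b1 b b3\<bar> < 2 * cmod (Delta_plus a b1 b b3)")
    case True
    then have "G b = hyp_locus (b / 2) (Delta_plus a b1 b b3) (M_plus a b1 b b3)"
      unfolding G_def by (intro real_points_block_curve) simp
    then show ?thesis using True by blast
  next
    case False
    then show ?thesis unfolding G_def by (intro disjI1 bounded_block_curve)
  qed
  have u': "G b2 \<union> G (- b2) = Hp \<union> Hm" "G (- b2) \<union> G b2 = Hp \<union> Hm"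
    using u unfolding generating_curve_J4_A4 G_def by auto
  from hyperbola_union_imp[OF H u'(1) G] hyperbola_union_imp[OF H u'(2) G]
  have nb: "\<not> bounded (G b2)" "\<not> bounded (G (- b2))" "G (- b2) \<noteq> G b2" by auto
  then have "b2 \<noteq> 0" by auto
  moreover have "\<bar>M_plus a b1 b b3\<bar> < 2 * cmod (Delta_plus a b1 b b3)" if "\<not> bounded (G b)" for b
    using that bounded_block_curve unfolding G_def by blast
  ultimately show ?R using nb unfolding Delta_minus_eq M_minus_eq by blast
qed

section \<open>Numerical range and pseudo-convex hull\<close>

text \<open>
  Here and below \<open>P = \<bar>x\<^sub>1\<bar>\<^sup>2 + \<bar>x\<^sub>4\<bar>\<^sup>2\<close>, \<open>N = \<bar>x\<^sub>2\<bar>\<^sup>2 + \<bar>x\<^sub>3\<bar>\<^sup>2\<close>,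
  \<open>\<Omega> = 2 (x\<^sub>1 cnj x\<^sub>2 + x\<^sub>4 cnj x\<^sub>3)\<close> and \<open>d = 2 Re (x\<^sub>2 cnj x\<^sub>3)\<close>.
\<close>

definition form_value :: "real \<Rightarrow> complex \<Rightarrow> complex \<Rightarrow> complex \<Rightarrow> real \<Rightarrow> real \<Rightarrow> complex \<Rightarrow> real \<Rightarrow> complex" where
  "form_value a b1 b2 b3 P N \<Omega> d =
     of_real (a * (P + N)) - b2 * of_real d + (b1 * cnj \<Omega> - b3 * \<Omega>) / 2"

definition form_data :: "real \<Rightarrow> real \<Rightarrow> complex \<Rightarrow> real \<Rightarrow> bool" where
  "form_data P N \<Omega> d \<longleftrightarrow> 0 \<le> P \<and> 0 \<le> N \<and> (cmod \<Omega>)\<^sup>2 \<le> 4 * P * N \<and> \<bar>d\<bar> \<le> N"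

lemma J4_A4_forms:
  fixes x :: "complex^4"
  defines "P \<equiv> (cmod (x$1))\<^sup>2 + (cmod (x$4))\<^sup>2" and "N \<equiv> (cmod (x$2))\<^sup>2 + (cmod (x$3))\<^sup>2"
    and "\<Omega> \<equiv> 2 * (x$1 * cnj (x$2) + x$4 * cnj (x$3))" and "d \<equiv> 2 * Re (x$2 * cnj (x$3))"
  shows "jprod J4 x x = of_real (P - N)"
    and "jprod J4 (A4 a b1 b2 b3 *v x) x = form_value a b1 b2 b3 P N \<Omega> d"
    and "form_data P N \<Omega> d"
proof -
  show "jprod J4 x x = of_real (P - N)"
    by (simp add: jprod_def J4_def matrix_vector_mult_def sum_4 vector_4 P_def N_def complex_eq_iff cmod_power2)
      (simp add: power2_eq_square algebra_simps)
  have "of_real P = cnj (x$1) * x$1 + cnj (x$4) * x$4" "of_real N = cnj (x$2) * x$2 + cnj (x$3) * x$3"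
    unfolding P_def N_def of_real_add complex_norm_square by (simp_all add: mult.commute)
  moreover have "complex_of_real d = x$2 * cnj (x$3) + x$3 * cnj (x$2)"
    by (simp add: d_def complex_eq_iff)
  ultimately show "jprod J4 (A4 a b1 b2 b3 *v x) x = form_value a b1 b2 b3 P N \<Omega> d"
    unfolding form_value_def \<Omega>_def of_real_mult of_real_add
    by (simp add: jprod_def J4_def A4_def matrix_vector_mult_def sum_4 vector_4)
      (simp add: field_simps)
  have "(cmod \<Omega>)\<^sup>2 + 4 * (cmod (x$1 * x$3 - x$4 * x$2))\<^sup>2 = 4 * P * N"
    \<comment> \<open>Lagrange's identity\<close>
    unfolding cmod_power2 P_def N_def \<Omega>_def by (simp add: power2_eq_square algebra_simps)
  then have "(cmod \<Omega>)\<^sup>2 \<le> 4 * P * N"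
    using zero_le_power2[of "cmod (x$1 * x$3 - x$4 * x$2)"] by linarith
  moreover have "\<bar>d\<bar> \<le> N"
  proof -
    have "\<bar>d\<bar> \<le> 2 * (cmod (x$2) * cmod (x$3))"
      using abs_Re_le_cmod[of "x$2 * cnj (x$3)"] by (simp add: d_def norm_mult abs_mult del: times_complex.sel)
    also have "\<dots> \<le> N" using sum_squares_bound[of "cmod (x$2)" "cmod (x$3)"] by (simp add: N_def)
    finally show ?thesis .
  qed
  ultimately show "form_data P N \<Omega> d" by (simp add: form_data_def P_def N_def)
qed

text \<open>The vector (x2, x3) is taken real. Then (x1, x4) has a component along it, fixed by
  \<Omega>, and an orthogonal one that supplies the remainder of P; the cone inequality says that
  this remainder is nonnegative.\<close>

lemma form_data_realised:
  assumes "form_data P N \<Omega> d"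
  obtains x :: "complex^4" where "jprod J4 x x = of_real (P - N)"
    "jprod J4 (A4 a b1 b2 b3 *v x) x = form_value a b1 b2 b3 P N \<Omega> d"
proof -
  have "\<exists>x :: complex^4. (cmod (x$1))\<^sup>2 + (cmod (x$4))\<^sup>2 = P \<and> (cmod (x$2))\<^sup>2 + (cmod (x$3))\<^sup>2 = N \<and>
      2 * (x$1 * cnj (x$2) + x$4 * cnj (x$3)) = \<Omega> \<and> 2 * Re (x$2 * cnj (x$3)) = d"
  proof (cases "N = 0")
    case True
    then have "d = 0" "\<Omega> = 0" "P \<ge> 0" using assms by (auto simp: form_data_def)
    then show ?thesis using True
      by (intro exI[of _ "vector [of_real (sqrt P), 0, 0, 0]"]) (simp add: vector_4)
  next
    case False
    then have N: "N > 0" "P \<ge> 0" "(cmod \<Omega>)\<^sup>2 \<le> 4 * P * N" "\<bar>d\<bar> \<le> N"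
      using assms by (auto simp: form_data_def)
    define s t where "s = sqrt (N + d)" and "t = sqrt (N - d)"
    have st: "s\<^sup>2 = N + d" "t\<^sup>2 = N - d" using N by (auto simp: s_def t_def)
    \<comment> \<open>Half sum and half difference turn s^2 = N + d and t^2 = N - d into y^2 + z^2 =
      N and 2 y z = d.\<close>
    define y z where "y = (s + t) / 2" and "z = (s - t) / 2"
    have yz: "y\<^sup>2 + z\<^sup>2 = N" "2 * (y * z) = d"
      using st unfolding y_def z_def by (simp_all add: power2_eq_square field_simps)
    define k where "k = \<Omega> / of_real (2 * N)"
    define r where "r = sqrt ((P - (cmod \<Omega>)\<^sup>2 / (4 * N)) / N)"
    have "(cmod \<Omega>)\<^sup>2 / (4 * N) \<le> P" using N by (simp add: field_simps)
    then have "r\<^sup>2 = (P - (cmod \<Omega>)\<^sup>2 / (4 * N)) / N" using N by (simp add: r_def)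
    moreover have "(cmod k)\<^sup>2 = (cmod \<Omega>)\<^sup>2 / (4 * N) / N"
      using N by (simp add: k_def norm_divide power_divide power2_eq_square)
    ultimately have "r\<^sup>2 * N = P - (cmod \<Omega>)\<^sup>2 / (4 * N)" "(cmod k)\<^sup>2 * N = (cmod \<Omega>)\<^sup>2 / (4 * N)"
      using N by simp_all
    then have rk: "((cmod k)\<^sup>2 + r\<^sup>2) * N = P" by (simp add: distrib_right)
    define u v where "u = k * of_real y - \<i> * of_real (r * z)" and "v = k * of_real z + \<i> * of_real (r * y)"
    have orth: "u * of_real y + v * of_real z = k * of_real N"
      unfolding u_def v_def yz(1)[symmetric] by (simp add: power2_eq_square algebra_simps)
    have uv: "(cmod u)\<^sup>2 + (cmod v)\<^sup>2 = ((cmod k)\<^sup>2 + r\<^sup>2) * N"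
      unfolding cmod_power2 yz(1)[symmetric] u_def v_def by (simp add: power2_eq_square algebra_simps)
    have "2 * (u * of_real y + v * of_real z) = \<Omega>" using N unfolding orth by (simp add: k_def)
    then show ?thesis using yz uv rk
      by (intro exI[of _ "vector [u, of_real y, of_real z, v]"]) (simp add: vector_4)
  qed
  then obtain x :: "complex^4" where x: "(cmod (x$1))\<^sup>2 + (cmod (x$4))\<^sup>2 = P"
    "(cmod (x$2))\<^sup>2 + (cmod (x$3))\<^sup>2 = N" "2 * (x$1 * cnj (x$2) + x$4 * cnj (x$3)) = \<Omega>"
    "2 * Re (x$2 * cnj (x$3)) = d" by blast
  show ?thesis
    by (rule that[of x]) (use J4_A4_forms(1,2)[where x = x] x in simp_all)
qed

lemma form_value_linear:
  "form_value a b1 b2 b3 (s * P + t * P') (s * N + t * N') (of_real s * \<Omega> + of_real t * \<Omega>') (s * d + t * d')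
    = of_real s * form_value a b1 b2 b3 P N \<Omega> d + of_real t * form_value a b1 b2 b3 P' N' \<Omega>' d'"
  by (simp add: form_value_def field_simps)

text \<open>|\<Omega>|^2 <= 4 P N is a Lorentz cone in P + N, P - N and \<Omega>. Its closure under
  addition reduces to the mixed term, where 2 sqrt(P N P' N') <= P N' + P' N is the inequality of
  the means.\<close>

lemma form_data_cone:
  assumes "form_data P N \<Omega> d" "form_data P' N' \<Omega>' d'" "s \<ge> 0" "t \<ge> 0"
  shows "form_data (s * P + t * P') (s * N + t * N') (of_real s * \<Omega> + of_real t * \<Omega>') (s * d + t * d')"
proof -
  note 1 = assms(1,2)[unfolded form_data_def]
  have c: "cmod \<Omega> \<le> 2 * sqrt (P * N)" "cmod \<Omega>' \<le> 2 * sqrt (P' * N')"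
    using 1 real_le_rsqrt[of "cmod \<Omega>" "4 * P * N"] real_le_rsqrt[of "cmod \<Omega>'" "4 * P' * N'"]
    by (simp_all add: real_sqrt_mult)
  have am: "2 * (sqrt (P * N) * sqrt (P' * N')) \<le> P * N' + P' * N"
  proof -
    have "sqrt (P * N) * sqrt (P' * N') = sqrt (P * N') * sqrt (P' * N)"
      by (simp add: real_sqrt_mult)
    also have "2 * \<dots> \<le> (sqrt (P * N'))\<^sup>2 + (sqrt (P' * N))\<^sup>2"
      using sum_squares_bound[of "sqrt (P * N')" "sqrt (P' * N)"] by simp
    finally show ?thesis using 1 by simp
  qed
  have "cmod (of_real s * \<Omega> + of_real t * \<Omega>') \<le> s * cmod \<Omega> + t * cmod \<Omega>'"
    using norm_triangle_ineq[of "of_real s * \<Omega>" "of_real t * \<Omega>'"] assms(3,4) by (simp add: norm_mult)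
  also have "\<dots> \<le> 2 * (s * sqrt (P * N) + t * sqrt (P' * N'))"
    using mult_left_mono[OF c(1) assms(3)] mult_left_mono[OF c(2) assms(4)] by simp
  finally have "(cmod (of_real s * \<Omega> + of_real t * \<Omega>'))\<^sup>2 \<le> (2 * (s * sqrt (P * N) + t * sqrt (P' * N')))\<^sup>2"
    by (rule power_mono) simp
  also have "\<dots> = 4 * (s\<^sup>2 * (sqrt (P * N))\<^sup>2 + t\<^sup>2 * (sqrt (P' * N'))\<^sup>2
      + s * t * (2 * (sqrt (P * N) * sqrt (P' * N'))))"
    by algebra
  also have "\<dots> = 4 * (s\<^sup>2 * (P * N) + t\<^sup>2 * (P' * N') + s * t * (2 * (sqrt (P * N) * sqrt (P' * N'))))"
    using 1 by simp
  also have "\<dots> \<le> 4 * (s\<^sup>2 * (P * N) + t\<^sup>2 * (P' * N') + s * t * (P * N' + P' * N))"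
    using mult_left_mono[OF am, of "s * t"] assms(3,4) by simp
  also have "\<dots> = 4 * (s * P + t * P') * (s * N + t * N')"
    by (simp add: power2_eq_square algebra_simps)
  finally have om: "(cmod (of_real s * \<Omega> + of_real t * \<Omega>'))\<^sup>2 \<le> 4 * (s * P + t * P') * (s * N + t * N')" .
  have "\<bar>s * d + t * d'\<bar> \<le> s * \<bar>d\<bar> + t * \<bar>d'\<bar>"
    using abs_triangle_ineq[of "s * d" "t * d'"] assms(3,4) by (simp add: abs_mult)
  also have "\<dots> \<le> s * N + t * N'"
    using 1 assms(3,4) by (intro add_mono mult_left_mono) auto
  finally have "\<bar>s * d + t * d'\<bar> \<le> s * N + t * N'" .
  moreover have "0 \<le> s * P + t * P'" "0 \<le> s * N + t * N'"
    using 1 assms(3,4) by (simp_all add: add_nonneg_nonneg)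
  ultimately show ?thesis using om unfolding form_data_def by blast
qed

lemma of_real_eq_minus_one_iff: "(of_real r :: complex) = - 1 \<longleftrightarrow> r = - 1"
  by (simp add: complex_eq_iff)

lemma jnum_range_iff:
  "z \<in> jnum_range J A \<longleftrightarrow>
    (\<exists>x. jprod J x x = 1 \<and> z = jprod J (A *v x) x \<or> jprod J x x = - 1 \<and> z = - jprod J (A *v x) x)"
  by (auto simp: jnum_range_def jnum_range_pos_def jnum_range_neg_def)

lemma jnum_range_J4_A4:
  "jnum_range J4 (A4 a b1 b2 b3) =
    {z. \<exists>P N \<Omega> d. form_data P N \<Omega> d \<and>
        (P - N = 1 \<and> z = form_value a b1 b2 b3 P N \<Omega> d \<or> P - N = - 1 \<and> z = - form_value a b1 b2 b3 P N \<Omega> d)}"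
    (is "?W = ?S")
proof (intro subset_antisym subsetI)
  fix z assume "z \<in> ?W"
  then obtain x :: "complex^4" where x: "jprod J4 x x = 1 \<and> z = jprod J4 (A4 a b1 b2 b3 *v x) x
     \<or> jprod J4 x x = - 1 \<and> z = - jprod J4 (A4 a b1 b2 b3 *v x) x"
    unfolding jnum_range_iff by (rule exE)
  define P N \<Omega> d where "P = (cmod (x$1))\<^sup>2 + (cmod (x$4))\<^sup>2" and "N = (cmod (x$2))\<^sup>2 + (cmod (x$3))\<^sup>2"
    and "\<Omega> = 2 * (x$1 * cnj (x$2) + x$4 * cnj (x$3))" and "d = 2 * Re (x$2 * cnj (x$3))"
  note F = J4_A4_forms[where x = x, folded P_def N_def \<Omega>_def d_def]
  have "P - N = 1 \<and> z = form_value a b1 b2 b3 P N \<Omega> d \<or> P - N = - 1 \<and> z = - form_value a b1 b2 b3 P N \<Omega> d"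
    using x unfolding F(1,2) of_real_eq_1_iff of_real_eq_minus_one_iff .
  then show "z \<in> ?S" using F(3) by blast
next
  fix z assume "z \<in> ?S"
  then obtain P N \<Omega> d where f: "form_data P N \<Omega> d" and
      z: "P - N = 1 \<and> z = form_value a b1 b2 b3 P N \<Omega> d \<or> P - N = - 1 \<and> z = - form_value a b1 b2 b3 P N \<Omega> d"
    unfolding mem_Collect_eq by (elim exE conjE) (rule that)
  obtain x :: "complex^4" where "jprod J4 x x = of_real (P - N)"
    "jprod J4 (A4 a b1 b2 b3 *v x) x = form_value a b1 b2 b3 P N \<Omega> d"
    by (rule form_data_realised[OF f])
  then have "jprod J4 x x = 1 \<and> z = jprod J4 (A4 a b1 b2 b3 *v x) x
     \<or> jprod J4 x x = - 1 \<and> z = - jprod J4 (A4 a b1 b2 b3 *v x) x"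
    using z by (elim disjE) simp_all
  then show "z \<in> ?W" unfolding jnum_range_iff by (rule exI)
qed

text \<open>For \<sigma> = 1 or -1 these are the points generated by vectors with [x,x] = \<sigma>.
  The factor \<sigma> on the left encodes both the division by [x,x] and the sign change in the
  negative part of the range.\<close>

definition form_point :: "real \<Rightarrow> complex \<Rightarrow> complex \<Rightarrow> complex \<Rightarrow> real \<Rightarrow> complex \<Rightarrow> bool" where
  "form_point a b1 b2 b3 \<sigma> z \<longleftrightarrow>
     (\<exists>P N \<Omega> d. form_data P N \<Omega> d \<and> P - N = \<sigma> \<and> of_real \<sigma> * z = form_value a b1 b2 b3 P N \<Omega> d)"

lemma jnum_range_form_point:
  "z \<in> jnum_range J4 (A4 a b1 b2 b3) \<longleftrightarrow> form_point a b1 b2 b3 1 z \<or> form_point a b1 b2 b3 (- 1) z"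
proof -
  have "of_real (- 1) * z = w \<longleftrightarrow> z = - w" for w :: complex by auto
  then show ?thesis unfolding jnum_range_J4_A4 form_point_def
    by (simp only: mem_Collect_eq ex_disj_distrib conj_disj_distribL of_real_1 mult_1_left)
qed

lemma generates_J4_A4:
  "(\<exists>x. generates J4 (A4 a b1 b2 b3) x z \<and> Re (jprod J4 x x) = \<sigma>) \<longleftrightarrow>
    \<sigma> \<in> {1, - 1} \<and> form_point a b1 b2 b3 \<sigma> z" (is "?L \<longleftrightarrow> ?R")
proof
  assume ?L
  then obtain x where g: "generates J4 (A4 a b1 b2 b3) x z" and r: "Re (jprod J4 x x) = \<sigma>" by blast
  have "jprod J4 x x = 1 \<or> jprod J4 x x = - 1" using g unfolding generates_def by (rule conjunct1)
  then have s: "\<sigma> \<in> {1, - 1}" using r by auto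
  have j: "jprod J4 x x = of_real \<sigma>" using r J4_A4_forms(1)[of x] by simp
  define P N \<Omega> d where "P = (cmod (x$1))\<^sup>2 + (cmod (x$4))\<^sup>2" and "N = (cmod (x$2))\<^sup>2 + (cmod (x$3))\<^sup>2"
    and "\<Omega> = 2 * (x$1 * cnj (x$2) + x$4 * cnj (x$3))" and "d = 2 * Re (x$2 * cnj (x$3))"
  note F = J4_A4_forms[where x = x, folded P_def N_def \<Omega>_def d_def]
  have "z = form_value a b1 b2 b3 P N \<Omega> d / of_real \<sigma>"
    using g unfolding generates_def F(2) j by (rule conjunct2)
  then have "of_real \<sigma> * z = form_value a b1 b2 b3 P N \<Omega> d" using s by auto
  moreover have "P - N = \<sigma>" using j unfolding F(1) of_real_eq_iff .
  ultimately have "form_point a b1 b2 b3 \<sigma> z"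
    unfolding form_point_def using F(3) by (intro exI conjI)
  then show ?R using s by blast
next
  assume ?R
  then obtain P N \<Omega> d where f: "form_data P N \<Omega> d" "P - N = \<sigma>" "of_real \<sigma> * z = form_value a b1 b2 b3 P N \<Omega> d"
    and s: "\<sigma> = 1 \<or> \<sigma> = - 1" unfolding form_point_def by blast
  obtain x :: "complex^4" where x: "jprod J4 x x = of_real (P - N)"
    "jprod J4 (A4 a b1 b2 b3 *v x) x = form_value a b1 b2 b3 P N \<Omega> d"
    by (rule form_data_realised[OF f(1)])
  have "generates J4 (A4 a b1 b2 b3) x z"
    using s unfolding generates_def x f(2) f(3)[symmetric] by (elim disjE) simp_all
  moreover have "Re (jprod J4 x x) = \<sigma>" using x(1) f(2) by simp
  ultimately show ?L by blast
qed

lemma form_point_convex: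
  assumes "form_point a b1 b2 b3 \<sigma> z" "form_point a b1 b2 b3 \<sigma> z'" "p \<in> closed_segment z z'"
  shows "form_point a b1 b2 b3 \<sigma> p"
proof -
  obtain P N \<Omega> d where f: "form_data P N \<Omega> d" "P - N = \<sigma>" "of_real \<sigma> * z = form_value a b1 b2 b3 P N \<Omega> d"
    using assms(1) unfolding form_point_def by blast
  obtain P' N' \<Omega>' d' where f': "form_data P' N' \<Omega>' d'" "P' - N' = \<sigma>"
      "of_real \<sigma> * z' = form_value a b1 b2 b3 P' N' \<Omega>' d'"
    using assms(2) unfolding form_point_def by blast
  obtain t where t: "0 \<le> t" "t \<le> 1" "p = of_real (1 - t) * z + of_real t * z'"
    using assms(3) by (auto simp: closed_segment_def scaleR_conv_of_real)
  have "(1 - t) * P + t * P' - ((1 - t) * N + t * N') = (1 - t) * (P - N) + t * (P' - N')"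
    by (simp add: algebra_simps)
  also have "\<dots> = \<sigma>" unfolding f(2) f'(2) by (simp add: algebra_simps)
  finally have "(1 - t) * P + t * P' - ((1 - t) * N + t * N') = \<sigma>" .
  moreover have "of_real \<sigma> * p = of_real (1 - t) * (of_real \<sigma> * z) + of_real t * (of_real \<sigma> * z')"
    unfolding t(3) by (simp add: algebra_simps)
  ultimately show ?thesis
    unfolding form_point_def f(3) f'(3) form_value_linear[symmetric]
    using form_data_cone[OF f(1) f'(1), of "1 - t" t] t(1,2)
    by (intro exI conjI) auto
qed

text \<open>A point z' of negative sign has form value -z', so nonnegative weights s, s' on the two
  data produce the value s z - s' z' with [x,x] = s - s'. Requiring s - s' to be 1 or -1 gives the
  two rays, one for each sign.\<close>

lemma form_point_outer_rays:
  assumes "form_point a b1 b2 b3 1 z" "form_point a b1 b2 b3 (- 1) z'"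
  shows "t \<ge> 1 \<Longrightarrow> form_point a b1 b2 b3 1 (of_real t * z + of_real (1 - t) * z')"
    and "t \<le> 0 \<Longrightarrow> form_point a b1 b2 b3 (- 1) (of_real t * z + of_real (1 - t) * z')"
proof -
  obtain P N \<Omega> d where f: "form_data P N \<Omega> d" "P - N = 1" "of_real 1 * z = form_value a b1 b2 b3 P N \<Omega> d"
    using assms(1) unfolding form_point_def by blast
  obtain P' N' \<Omega>' d' where f': "form_data P' N' \<Omega>' d'" "P' - N' = - 1"
      "of_real (- 1) * z' = form_value a b1 b2 b3 P' N' \<Omega>' d'"
    using assms(2) unfolding form_point_def by blast
  have *: "form_point a b1 b2 b3 \<sigma> p" if "s \<ge> 0" "s' \<ge> 0" "s - s' = \<sigma>"
    "of_real \<sigma> * p = of_real s * z - of_real s' * z'" for s s' \<sigma> p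
  proof -
    have "s * P + s' * P' - (s * N + s' * N') = s * (P - N) + s' * (P' - N')"
      by (simp add: algebra_simps)
    also have "\<dots> = \<sigma>" unfolding f(2) f'(2) using that(3) by simp
    finally have "s * P + s' * P' - (s * N + s' * N') = \<sigma>" .
    moreover have "of_real \<sigma> * p = form_value a b1 b2 b3 (s * P + s' * P') (s * N + s' * N')
        (of_real s * \<Omega> + of_real s' * \<Omega>') (s * d + s' * d')"
      unfolding form_value_linear that(4) f(3)[symmetric] f'(3)[symmetric] by simp
    ultimately show ?thesis
      unfolding form_point_def using form_data_cone[OF f(1) f'(1) that(1,2)] by (intro exI conjI)
  qed
  show "form_point a b1 b2 b3 1 (of_real t * z + of_real (1 - t) * z')" if "t \<ge> 1"
    using that by (intro *[of t "t - 1"]) (auto simp: algebra_simps)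
  show "form_point a b1 b2 b3 (- 1) (of_real t * z + of_real (1 - t) * z')" if "t \<le> 0"
    using that by (intro *[of "- t" "1 - t"]) (auto simp: algebra_simps)
qed

lemma pseudo_convex_hull_J4_A4:
  "p \<in> pseudo_convex_hull J4 (A4 a b1 b2 b3) C \<longleftrightarrow>
    (\<exists>z1\<in>C. \<exists>z2\<in>C. \<exists>\<sigma>1\<in>{1, - 1}. \<exists>\<sigma>2\<in>{1, - 1}.
       form_point a b1 b2 b3 \<sigma>1 z1 \<and> form_point a b1 b2 b3 \<sigma>2 z2 \<and>
       (\<sigma>1 = \<sigma>2 \<and> p \<in> closed_segment z1 z2 \<or> \<sigma>1 \<noteq> \<sigma>2 \<and> p \<in> outer_rays z1 z2))"
    (is "?L \<longleftrightarrow> ?R")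
proof
  assume ?L
  then obtain z1 z2 x y where z: "z1 \<in> C" "z2 \<in> C" "generates J4 (A4 a b1 b2 b3) x z1"
    "generates J4 (A4 a b1 b2 b3) y z2"
    "Re (jprod J4 x x) * Re (jprod J4 y y) > 0 \<and> p \<in> closed_segment z1 z2 \<or>
     Re (jprod J4 x x) * Re (jprod J4 y y) < 0 \<and> p \<in> outer_rays z1 z2"
    unfolding pseudo_convex_hull_def by blast
  define s t where "s = Re (jprod J4 x x)" and "t = Re (jprod J4 y y)"
  have 1: "s \<in> {1, - 1}" "form_point a b1 b2 b3 s z1" using generates_J4_A4 z(3) s_def by blast+
  have 2: "t \<in> {1, - 1}" "form_point a b1 b2 b3 t z2" using generates_J4_A4 z(4) t_def by blast+
  have "s = t \<and> p \<in> closed_segment z1 z2 \<or> s \<noteq> t \<and> p \<in> outer_rays z1 z2"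
    using z(5) 1(1) 2(1) unfolding s_def[symmetric] t_def[symmetric] by auto
  then show ?R using z(1,2) 1 2 by blast
next
  assume ?R
  then obtain z1 z2 s t where z: "z1 \<in> C" "z2 \<in> C" "s \<in> {1, - 1}" "t \<in> {1, - 1}"
    "form_point a b1 b2 b3 s z1" "form_point a b1 b2 b3 t z2"
    "s = t \<and> p \<in> closed_segment z1 z2 \<or> s \<noteq> t \<and> p \<in> outer_rays z1 z2" by blast
  obtain x where x: "generates J4 (A4 a b1 b2 b3) x z1" "Re (jprod J4 x x) = s"
    using generates_J4_A4 z(3,5) by blast
  obtain y where y: "generates J4 (A4 a b1 b2 b3) y z2" "Re (jprod J4 y y) = t"
    using generates_J4_A4 z(4,6) by blast
  have "Re (jprod J4 x x) * Re (jprod J4 y y) > 0 \<and> p \<in> closed_segment z1 z2 \<or>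
     Re (jprod J4 x x) * Re (jprod J4 y y) < 0 \<and> p \<in> outer_rays z1 z2"
    unfolding x(2) y(2) using z(3,4,7) by auto
  then show ?L unfolding pseudo_convex_hull_def using z(1,2) x(1) y(1) by blast
qed

text \<open>Valid for every set C, since the generating vectors already put the two end points into
  the range and the admissible data form a convex cone.\<close>

lemma pseudo_convex_hull_subset_jnum_range:
  "pseudo_convex_hull J4 (A4 a b1 b2 b3) C \<subseteq> jnum_range J4 (A4 a b1 b2 b3)"
proof
  fix p assume "p \<in> pseudo_convex_hull J4 (A4 a b1 b2 b3) C"
  then obtain z1 z2 s t where z: "s = 1 \<or> s = - 1" "t = 1 \<or> t = - 1"
    "form_point a b1 b2 b3 s z1" "form_point a b1 b2 b3 t z2"
    "s = t \<and> p \<in> closed_segment z1 z2 \<or> s \<noteq> t \<and> p \<in> outer_rays z1 z2"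
    unfolding pseudo_convex_hull_J4_A4 by blast
  have swap: "outer_rays z1 z2 = outer_rays z2 z1" for z1 z2
  proof -
    have "outer_rays z1 z2 \<subseteq> outer_rays z2 z1" for z1 z2
    proof
      fix q assume "q \<in> outer_rays z1 z2"
      then obtain t where "q = of_real t * z1 + of_real (1 - t) * z2" "t \<le> 0 \<or> 1 \<le> t"
        by (auto simp: outer_rays_def)
      then show "q \<in> outer_rays z2 z1"
        unfolding outer_rays_def by (intro CollectI exI[of _ "1 - t"]) auto
    qed
    then show ?thesis by blast
  qed
  have opp: "p \<in> jnum_range J4 (A4 a b1 b2 b3)"
    if "form_point a b1 b2 b3 1 z" "form_point a b1 b2 b3 (- 1) z'" "p \<in> outer_rays z z'" for z z'
    using that(3) form_point_outer_rays[OF that(1,2)] unfolding jnum_range_form_point outer_rays_def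
    by blast
  show "p \<in> jnum_range J4 (A4 a b1 b2 b3)"
  proof (cases "s = t")
    case True
    then have "form_point a b1 b2 b3 s p" using form_point_convex[of a b1 b2 b3 s z1 z2 p] z by simp
    then show ?thesis using z(1) unfolding jnum_range_form_point by blast
  next
    case False
    then have "p \<in> outer_rays z1 z2" using z(5) by blast
    then show ?thesis using False z(1-4) opp[of z1 z2] opp[of z2 z1] swap[of z1 z2] by auto
  qed
qed

section \<open>The range of a block\<close>

text \<open>
  Linear functionals on \<open>\<real> \<times> \<complex>\<close> are written \<open>(S, \<Omega>) \<mapsto> x0 S + Re (\<xi> cnj \<Omega>)\<close> and carry the
  Lorentz form \<open>x0\<^sup>2 - \<bar>\<xi>\<bar>\<^sup>2\<close>.  Given orthogonal functionals of squared length \<open>A\<^sup>2\<close> and \<open>- B\<^sup>2\<close>,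
  this is the unit functional supporting the image at the boundary point with coordinates \<open>(A C, B Y)\<close>.
\<close>

lemma lorentz_dual_unit:
  fixes x0 y0 A B C Y :: real and \<xi> \<eta> :: complex
  assumes A: "A > 0" "x0\<^sup>2 - (cmod \<xi>)\<^sup>2 = A\<^sup>2" and B: "B > 0" "y0\<^sup>2 - (cmod \<eta>)\<^sup>2 = - B\<^sup>2"
    and orth: "x0 * y0 = Re (\<xi> * cnj \<eta>)" and "x0 > 0" and C: "C > 0" "C\<^sup>2 = 1 + Y\<^sup>2"
  defines "f0 \<equiv> C / A * x0 - Y / B * y0" and "f \<equiv> of_real (C / A) * \<xi> - of_real (Y / B) * \<eta>"
  shows "f0 > 0" and "f0\<^sup>2 - (cmod f)\<^sup>2 = 1"
proof -
  have gen: "(k * x0 - l * y0)\<^sup>2 - (cmod (of_real k * \<xi> - of_real l * \<eta>))\<^sup>2 =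
      k\<^sup>2 * (x0\<^sup>2 - (cmod \<xi>)\<^sup>2) + l\<^sup>2 * (y0\<^sup>2 - (cmod \<eta>)\<^sup>2)
      - 2 * k * l * (x0 * y0 - Re (\<xi> * cnj \<eta>))" for k l
    unfolding cmod_power2 by simp algebra
  have "f0\<^sup>2 - (cmod f)\<^sup>2 = (C / A)\<^sup>2 * (x0\<^sup>2 - (cmod \<xi>)\<^sup>2) + (Y / B)\<^sup>2 * (y0\<^sup>2 - (cmod \<eta>)\<^sup>2)
      - 2 * (C / A) * (Y / B) * (x0 * y0 - Re (\<xi> * cnj \<eta>))"
    unfolding f0_def f_def by (rule gen)
  also have "\<dots> = C\<^sup>2 - Y\<^sup>2"
    unfolding A(2) B(2) using A(1) B(1) orth by (simp add: power_divide)
  finally show "f0\<^sup>2 - (cmod f)\<^sup>2 = 1" using C by simp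
  \<comment> \<open>Positivity of \<open>f0\<close>: orthogonality and Cauchy-Schwarz in the plane
    give |y0|/B < x0/A, and |Y| <= C, so the first term outweighs the second.\<close>
  have "(x0 * y0)\<^sup>2 \<le> (cmod \<xi>)\<^sup>2 * (cmod \<eta>)\<^sup>2"
  proof -
    have "\<bar>x0 * y0\<bar> \<le> cmod \<xi> * cmod \<eta>"
      using abs_Re_le_cmod[of "\<xi> * cnj \<eta>"] unfolding orth norm_mult complex_mod_cnj .
    then have "\<bar>x0 * y0\<bar>\<^sup>2 \<le> (cmod \<xi> * cmod \<eta>)\<^sup>2" by (rule power_mono) simp
    then show ?thesis by (simp only: power2_abs power_mult_distrib)
  qed
  also have "\<dots> = (x0\<^sup>2 - A\<^sup>2) * (y0\<^sup>2 + B\<^sup>2)"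
  proof -
    have "(cmod \<xi>)\<^sup>2 = x0\<^sup>2 - A\<^sup>2" "(cmod \<eta>)\<^sup>2 = y0\<^sup>2 + B\<^sup>2" using A(2) B(2) by linarith+
    then show ?thesis by simp
  qed
  finally have "(\<bar>y0\<bar> * A)\<^sup>2 + A\<^sup>2 * B\<^sup>2 \<le> (x0 * B)\<^sup>2"
    by (simp add: power_mult_distrib algebra_simps)
  moreover have "A\<^sup>2 * B\<^sup>2 > 0" using A(1) B(1) by simp
  ultimately have "(\<bar>y0\<bar> * A)\<^sup>2 < (x0 * B)\<^sup>2" by linarith
  then have "\<bar>y0\<bar> * A < x0 * B" by (rule power2_less_imp_less) (use B(1) \<open>x0 > 0\<close> in simp)
  then have yx: "\<bar>y0\<bar> / B < x0 / A" using A(1) B(1) by (simp add: divide_simps mult.commute)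
  have "\<bar>Y\<bar> \<le> C" by (rule power2_le_imp_le) (use C in simp_all)
  have "Y / B * y0 \<le> \<bar>Y\<bar> * (\<bar>y0\<bar> / B)"
    using abs_ge_self[of "Y / B * y0"] B(1) by (simp add: abs_mult)
  also have "\<dots> \<le> C * (\<bar>y0\<bar> / B)" using \<open>\<bar>Y\<bar> \<le> C\<close> B(1) by (intro mult_right_mono) auto
  also have "\<dots> < C * (x0 / A)" using yx C(1) by (rule mult_strict_left_mono)
  finally show "f0 > 0" by (simp add: f0_def)
qed

text \<open>The first claim is the reversed Cauchy-Schwarz inequality f0 S + Re (f cnj \<Omega>) >=
  1 for the unit functional attached to the point's own second coordinate: it reads c X / A - y^2 >=
  1 = c^2 - y^2. The second claim needs a vector attaining equality, and (f0, - f), dual to the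
  functional under the Lorentz form, is one.\<close>

lemma lorentz_image:
  fixes x0 y0 A B :: real and \<xi> \<eta> :: complex
  assumes A: "A > 0" "x0\<^sup>2 - (cmod \<xi>)\<^sup>2 = A\<^sup>2" and B: "B > 0" "y0\<^sup>2 - (cmod \<eta>)\<^sup>2 = - B\<^sup>2"
    and orth: "x0 * y0 = Re (\<xi> * cnj \<eta>)" and "x0 > 0"
  shows "S \<ge> 0 \<Longrightarrow> S\<^sup>2 - (cmod \<Omega>)\<^sup>2 \<ge> 1 \<Longrightarrow>
      x0 * S + Re (\<xi> * cnj \<Omega>) \<ge> A * cmod (Complex 1 ((y0 * S + Re (\<eta> * cnj \<Omega>)) / B))"
    and "X = A * cmod (Complex 1 (Y / B)) \<Longrightarrow>
      \<exists>S \<Omega>. S > 0 \<and> S\<^sup>2 - (cmod \<Omega>)\<^sup>2 = 1 \<and> X = x0 * S + Re (\<xi> * cnj \<Omega>) \<and> Y = y0 * S + Re (\<eta> * cnj \<Omega>)"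
proof -
  have C: "cmod (Complex 1 y) > 0" "(cmod (Complex 1 y))\<^sup>2 = 1 + y\<^sup>2" for y
    by (simp_all add: complex_eq_iff cmod_power2)
  note unit = lorentz_dual_unit[OF A B orth \<open>x0 > 0\<close> C]
  show "x0 * S + Re (\<xi> * cnj \<Omega>) \<ge> A * cmod (Complex 1 ((y0 * S + Re (\<eta> * cnj \<Omega>)) / B))"
    if S: "S \<ge> 0" "S\<^sup>2 - (cmod \<Omega>)\<^sup>2 \<ge> 1"
  proof -
    define X where "X = x0 * S + Re (\<xi> * cnj \<Omega>)"
    define y where "y = (y0 * S + Re (\<eta> * cnj \<Omega>)) / B"
    define c where "c = cmod (Complex 1 y)"
    define f0 f where "f0 = c / A * x0 - y / B * y0" and "f = of_real (c / A) * \<xi> - of_real (y / B) * \<eta>"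
    have c: "c > 0" "c\<^sup>2 = 1 + y\<^sup>2" using C[of y] by (simp_all add: c_def)
    have f: "f0 > 0" "f0\<^sup>2 - (cmod f)\<^sup>2 = 1"
      using unit[of y] unfolding f0_def f_def c_def by blast+
    have "(1 + cmod f * cmod \<Omega>)\<^sup>2 \<le> (1 + (cmod f)\<^sup>2) * (1 + (cmod \<Omega>)\<^sup>2)"
      using zero_le_power2[of "cmod f - cmod \<Omega>"] by (simp add: power2_eq_square algebra_simps)
    also have "\<dots> \<le> f0\<^sup>2 * S\<^sup>2"
      using f(2) S(2) by (intro mult_mono) auto
    also have "\<dots> = (f0 * S)\<^sup>2" by (simp add: power_mult_distrib)
    finally have "1 + cmod f * cmod \<Omega> \<le> f0 * S"
      by (rule power2_le_imp_le) (use f(1) S(1) in simp)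
    moreover have "- (cmod f * cmod \<Omega>) \<le> Re (f * cnj \<Omega>)"
      using abs_Re_le_cmod[of "f * cnj \<Omega>"] unfolding norm_mult complex_mod_cnj by linarith
    ultimately have "1 \<le> f0 * S + Re (f * cnj \<Omega>)" by linarith
    also have "\<dots> = c / A * X - y / B * (y0 * S + Re (\<eta> * cnj \<Omega>))"
      by (simp add: f0_def f_def X_def) algebra
    also have "\<dots> = c / A * X - y\<^sup>2" using B(1) by (simp add: y_def power2_eq_square)
    finally have "c * c \<le> c * (X / A)" using c(2) by (simp add: power2_eq_square)
    then have "c \<le> X / A" by (rule mult_left_le_imp_le) (rule c(1))
    then show ?thesis unfolding X_def[symmetric] y_def[symmetric] c_def[symmetric]
      using A(1) by (simp add: field_simps)
  qed
  show "\<exists>S \<Omega>. S > 0 \<and> S\<^sup>2 - (cmod \<Omega>)\<^sup>2 = 1 \<and> X = x0 * S + Re (\<xi> * cnj \<Omega>) \<and> Y = y0 * S + Re (\<eta> * cnj \<Omega>)"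
    if X: "X = A * cmod (Complex 1 (Y / B))"
  proof -
    define y where "y = Y / B"
    define c where "c = cmod (Complex 1 y)"
    define f0 f where "f0 = c / A * x0 - y / B * y0" and "f = of_real (c / A) * \<xi> - of_real (y / B) * \<eta>"
    have f: "f0 > 0" "f0\<^sup>2 - (cmod f)\<^sup>2 = 1"
      using unit[of y] unfolding f0_def f_def c_def by blast+
    have re: "Re (\<eta> * cnj \<xi>) = Re (\<xi> * cnj \<eta>)" "Re (z * cnj z) = (cmod z)\<^sup>2" for z
      unfolding cmod_power2 by (simp_all add: power2_eq_square algebra_simps)
    have "x0 * f0 + Re (\<xi> * cnj (- f)) =
        c / A * (x0\<^sup>2 - Re (\<xi> * cnj \<xi>)) - y / B * (x0 * y0 - Re (\<xi> * cnj \<eta>))"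
      by (simp add: f0_def f_def) algebra
    also have "\<dots> = X" unfolding re A(2) orth X using A(1) by (simp add: c_def y_def power2_eq_square)
    finally have 1: "X = x0 * f0 + Re (\<xi> * cnj (- f))" ..
    have "y0 * f0 + Re (\<eta> * cnj (- f)) =
        c / A * (x0 * y0 - Re (\<eta> * cnj \<xi>)) - y / B * (y0\<^sup>2 - Re (\<eta> * cnj \<eta>))"
      by (simp add: f0_def f_def) algebra
    also have "\<dots> = Y" unfolding re B(2) orth using B(1) by (simp add: y_def power2_eq_square)
    finally have 2: "Y = y0 * f0 + Re (\<eta> * cnj (- f))" ..
    show ?thesis using f 1 2 by (intro exI[of _ f0] exI[of _ "- f"]) simp
  qed
qed

text \<open>Points generated by vectors with \<open>d = N\<close>, that is \<open>x\<^sub>2 = x\<^sub>3\<close>; replacing b2 by \<open>- b2\<close> gives \<open>d = - N\<close>.\<close>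

definition block_point :: "real \<Rightarrow> complex \<Rightarrow> complex \<Rightarrow> complex \<Rightarrow> real \<Rightarrow> complex \<Rightarrow> bool" where
  "block_point a b1 b2 b3 \<sigma> z \<longleftrightarrow>
     (\<exists>P N \<Omega>. form_data P N \<Omega> N \<and> P - N = \<sigma> \<and> of_real \<sigma> * z = form_value a b1 b2 b3 P N \<Omega> N)"

lemma form_value_uminus: "form_value a b1 (- b2) b3 P N \<Omega> d = form_value a b1 b2 b3 P N \<Omega> (- d)"
  by (simp add: form_value_def)

lemma form_data_uminus: "form_data P N \<Omega> (- d) \<longleftrightarrow> form_data P N \<Omega> d"
  by (simp add: form_data_def)

lemma form_point_uminus: "form_point a b1 (- b2) b3 \<sigma> z \<longleftrightarrow> form_point a b1 b2 b3 \<sigma> z"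
proof -
  have "form_point a b1 b2 b3 \<sigma> z" if "form_point a b1 (- b2) b3 \<sigma> z" for b2
    using that unfolding form_point_def form_value_uminus
    by (elim exE conjE) (intro exI conjI, rule form_data_uminus[THEN iffD2])
  from this[of b2] this[of "- b2"] show ?thesis by auto
qed

lemma block_point_imp_form_point:
  assumes "block_point a b1 b2 b3 \<sigma> z"
  shows "form_point a b1 b2 b3 \<sigma> z"
  using assms unfolding block_point_def form_point_def by (elim exE) (intro exI)

text \<open>For fixed P, N and \<Omega> the value is affine in d, and d ranges over [-N, N]; the end
  points of this interval belong to the two blocks.\<close>

lemma form_point_between_blocks:
  assumes "form_point a b1 b2 b3 \<sigma> p" "\<sigma> \<in> {1, - 1}"
  obtains p1 p2 where "block_point a b1 b2 b3 \<sigma> p1" "block_point a b1 (- b2) b3 \<sigma> p2" "p \<in> closed_segment p1 p2"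
proof -
  obtain P N \<Omega> d where f: "form_data P N \<Omega> d" "P - N = \<sigma>" "of_real \<sigma> * p = form_value a b1 b2 b3 P N \<Omega> d"
    using assms(1) unfolding form_point_def by (elim exE conjE) (rule that)
  have s: "of_real \<sigma> * (of_real \<sigma> * z) = z" for z :: complex using assms(2) by auto
  have N: "0 \<le> N" "\<bar>d\<bar> \<le> N" using f(1) by (auto simp: form_data_def)
  have fd: "form_data P N \<Omega> N" using f(1) by (auto simp: form_data_def)
  define p1 p2 where "p1 = of_real \<sigma> * form_value a b1 b2 b3 P N \<Omega> N"
    and "p2 = of_real \<sigma> * form_value a b1 (- b2) b3 P N \<Omega> N"
  have "block_point a b1 b2 b3 \<sigma> p1"
    unfolding block_point_def using fd f(2) s by (intro exI conjI) (auto simp: p1_def)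
  moreover have "block_point a b1 (- b2) b3 \<sigma> p2"
    unfolding block_point_def using fd f(2) s by (intro exI conjI) (auto simp: p2_def)
  moreover have "p \<in> closed_segment p1 p2"
  proof -
    obtain t where t: "0 \<le> t" "t \<le> 1" "d = (1 - t) * N + t * (- N)"
    proof (cases "N = 0")
      case True
      then show ?thesis using that[of 0] N by simp
    next
      case False
      then show ?thesis using that[of "(N - d) / (2 * N)"] N by (simp add: field_simps)
    qed
    have "p = of_real \<sigma> * form_value a b1 b2 b3 P N \<Omega> d" using f(3) s[of p] by simp
    also have "\<dots> = of_real (1 - t) * p1 + of_real t * p2"
      unfolding p1_def p2_def form_value_uminus form_value_def t(3) by (simp add: field_simps)
    finally show ?thesis
      using t(1,2) unfolding in_segment scaleR_conv_of_real by blast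
  qed
  ultimately show ?thesis by (rule that)
qed

text \<open>With S = P + N and P - N = \<sigma> one has 4 P N = S^2 - 1, so the cone condition
  becomes S^2 - |\<Omega>|^2 >= 1. Because N = (S - \<sigma>)/2, the term b2 N splits into a
  multiple of S and the shift of the centre to b2/2.\<close>

lemma block_point_coordinates:
  assumes "\<sigma> \<in> {1, - 1}"
  shows "block_point a b1 b2 b3 \<sigma> z \<longleftrightarrow>
    (\<exists>S \<Omega>. 0 \<le> S \<and> 1 \<le> S\<^sup>2 - (cmod \<Omega>)\<^sup>2 \<and>
       of_real \<sigma> * (z - b2 / 2) = (of_real a - b2 / 2) * of_real S + (b1 * cnj \<Omega> - b3 * \<Omega>) / 2)"
proof
  have s2: "\<sigma>\<^sup>2 = 1" using assms by auto
  {
    assume "block_point a b1 b2 b3 \<sigma> z"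
    then obtain P N \<Omega> where f: "form_data P N \<Omega> N" "P - N = \<sigma>" "of_real \<sigma> * z = form_value a b1 b2 b3 P N \<Omega> N"
      unfolding block_point_def by (elim exE conjE) (rule that)
    have "(P + N)\<^sup>2 - 4 * P * N = 1"
      using s2 unfolding f(2)[symmetric] by (simp add: power2_eq_square algebra_simps)
    then have "1 \<le> (P + N)\<^sup>2 - (cmod \<Omega>)\<^sup>2" "0 \<le> P + N" using f(1) by (auto simp: form_data_def)
    moreover have "of_real \<sigma> * (z - b2 / 2) = (of_real a - b2 / 2) * of_real (P + N) + (b1 * cnj \<Omega> - b3 * \<Omega>) / 2"
    proof -
      have "of_real \<sigma> * (z - b2 / 2) = of_real \<sigma> * z - of_real \<sigma> * b2 / 2" by (simp add: field_simps)
      also have "\<dots> = form_value a b1 b2 b3 P N \<Omega> N - of_real (P - N) * b2 / 2" unfolding f(2,3) ..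
      also have "\<dots> = (of_real a - b2 / 2) * of_real (P + N) + (b1 * cnj \<Omega> - b3 * \<Omega>) / 2"
        by (simp add: form_value_def field_simps)
      finally show ?thesis .
    qed
    ultimately show "\<exists>S \<Omega>. 0 \<le> S \<and> 1 \<le> S\<^sup>2 - (cmod \<Omega>)\<^sup>2 \<and>
       of_real \<sigma> * (z - b2 / 2) = (of_real a - b2 / 2) * of_real S + (b1 * cnj \<Omega> - b3 * \<Omega>) / 2"
      by (intro exI conjI)
  }
  {
    assume "\<exists>S \<Omega>. 0 \<le> S \<and> 1 \<le> S\<^sup>2 - (cmod \<Omega>)\<^sup>2 \<and>
       of_real \<sigma> * (z - b2 / 2) = (of_real a - b2 / 2) * of_real S + (b1 * cnj \<Omega> - b3 * \<Omega>) / 2"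
    then obtain S \<Omega> where S: "0 \<le> S" "1 \<le> S\<^sup>2 - (cmod \<Omega>)\<^sup>2"
      "of_real \<sigma> * (z - b2 / 2) = (of_real a - b2 / 2) * of_real S + (b1 * cnj \<Omega> - b3 * \<Omega>) / 2"
      by (elim exE conjE) (rule that)
    define P N where "P = (S + \<sigma>) / 2" and "N = (S - \<sigma>) / 2"
    have "1\<^sup>2 \<le> S\<^sup>2" unfolding power_one using S(2) zero_le_power2[of "cmod \<Omega>"] by linarith
    then have S1: "1 \<le> S" by (rule power2_le_imp_le) (rule S(1))
    have "4 * P * N = S\<^sup>2 - \<sigma>\<^sup>2" by (simp add: P_def N_def power2_eq_square field_simps)
    then have "(cmod \<Omega>)\<^sup>2 \<le> 4 * P * N" using S(2) s2 by linarith
    moreover have "0 \<le> P" "0 \<le> N" using S1 assms by (auto simp: P_def N_def)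
    ultimately have "form_data P N \<Omega> N" by (simp add: form_data_def)
    moreover have PN: "P - N = \<sigma>" "P + N = S" by (simp_all add: P_def N_def field_simps)
    moreover have "of_real \<sigma> * z = form_value a b1 b2 b3 P N \<Omega> N"
    proof -
      have "of_real \<sigma> * z = of_real \<sigma> * (z - b2 / 2) + of_real \<sigma> * b2 / 2" by (simp add: field_simps)
      also have "\<dots> = (of_real a - b2 / 2) * of_real S + (b1 * cnj \<Omega> - b3 * \<Omega>) / 2 + of_real \<sigma> * b2 / 2"
        unfolding S(3) ..
      also have "\<dots> = form_value a b1 b2 b3 P N \<Omega> N"
        unfolding form_value_def PN(1)[symmetric] PN(2)[symmetric] by (simp add: field_simps)
      finally show ?thesis .
    qed
    ultimately show "block_point a b1 b2 b3 \<sigma> z" unfolding block_point_def by blast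
  }
qed

text \<open>After rotation by \<open>cnj e\<close> the real and imaginary parts of a block value are
  the functionals (x0, \<xi>) and (y0, \<eta>). Their Lorentz lengths A^2 and -B^2 and their
  orthogonality come from two identities: the rotated D is the real number |D|, and the norms
  combine to m.\<close>

lemma block_region:
  fixes a b1 b2 b3
  defines "m \<equiv> M_plus a b1 b2 b3" and "D \<equiv> Delta_plus a b1 b2 b3"
  assumes "\<bar>m\<bar> < 2 * cmod D"
  obtains e A B where "cmod e = 1" "D = e\<^sup>2 * of_real (cmod D)" "A > 0" "B > 0"
    "A\<^sup>2 = (2 * cmod D + m) / 4" "B\<^sup>2 = (2 * cmod D - m) / 4"
    "\<forall>\<sigma>\<in>{1, - 1}. \<forall>z. block_point a b1 b2 b3 \<sigma> z \<longrightarrow> branch_gap (b2 / 2) (of_real \<sigma> * e) A B z \<ge> 0"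
    "\<forall>\<sigma>\<in>{1, - 1}. \<forall>z. branch_gap (b2 / 2) (of_real \<sigma> * e) A B z = 0 \<longrightarrow> block_point a b1 b2 b3 \<sigma> z"
proof -
  define \<alpha> where "\<alpha> = of_real a - b2 / 2"
  obtain e' A B where e': "cmod e' = 1" "D = e'\<^sup>2 * of_real (cmod D)" "A > 0" "B > 0"
    "A\<^sup>2 = (2 * cmod D + m) / 4" "B\<^sup>2 = (2 * cmod D - m) / 4"
    by (rule hyperbola_axes_exist[OF assms(3)])
  \<comment> \<open>This sign gives x0 >= 0, so that the sheet S > 0 is sent to the side of
    direction \<open>e\<close> for \<sigma> = 1 and to the opposite side for \<sigma> = -1.\<close>
  define e where "e = (if Re (cnj e' * \<alpha>) \<ge> 0 then e' else - e')"
  have e: "cmod e = 1" "D = e\<^sup>2 * of_real (cmod D)" using e'(1,2) by (auto simp: e_def)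
  have cee: "cnj e * e = 1" using e(1) complex_norm_square[of e] by (simp add: mult.commute)
  define x0 y0 where "x0 = Re (cnj e * \<alpha>)" and "y0 = Im (cnj e * \<alpha>)"
  define \<beta> \<gamma> where "\<beta> = cnj e * b1 / 2" and "\<gamma> = cnj e * b3 / 2"
  define \<xi> \<eta> where "\<xi> = \<beta> - cnj \<gamma>" and "\<eta> = - \<i> * (\<beta> + cnj \<gamma>)"
  have coord: "cnj e * (\<alpha> * of_real S + (b1 * cnj \<Omega> - b3 * \<Omega>) / 2) =
      Complex (x0 * S + Re (\<xi> * cnj \<Omega>)) (y0 * S + Re (\<eta> * cnj \<Omega>))" for S \<Omega>
  proof -
    have "cnj e * (\<alpha> * of_real S + (b1 * cnj \<Omega> - b3 * \<Omega>) / 2)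
        = cnj e * \<alpha> * of_real S + (\<beta> * cnj \<Omega> - \<gamma> * \<Omega>)"
      by (simp add: \<beta>_def \<gamma>_def field_simps)
    also have "cnj e * \<alpha> = Complex x0 y0" unfolding x0_def y0_def complex_surj ..
    finally show ?thesis by (simp add: complex_eq_iff \<xi>_def \<eta>_def algebra_simps)
  qed
  have D: "D = \<alpha>\<^sup>2 + b1 * b3"
    by (simp add: D_def \<alpha>_def Delta_plus_def Delta_def power2_eq_square field_simps)
  have m: "m = 2 * (cmod \<alpha>)\<^sup>2 - (cmod b1)\<^sup>2 - (cmod b3)\<^sup>2"
    unfolding m_def M_plus_def M_def \<alpha>_def cmod_power2 by (simp add: power2_eq_square field_simps)
  have "(cnj e * \<alpha>)\<^sup>2 + 4 * \<beta> * \<gamma> = (cnj e)\<^sup>2 * D"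
    unfolding D \<beta>_def \<gamma>_def by (simp add: power2_eq_square algebra_simps)
  also have "\<dots> = (cnj e * e)\<^sup>2 * of_real (cmod D)" by (subst e(2)) (simp add: power_mult_distrib)
  finally have sq: "(cnj e * \<alpha>)\<^sup>2 + 4 * \<beta> * \<gamma> = of_real (cmod D)" by (simp add: cee)
  have re: "x0\<^sup>2 - y0\<^sup>2 + 4 * (Re \<beta> * Re \<gamma> - Im \<beta> * Im \<gamma>) = cmod D"
    using arg_cong[OF sq, of Re] unfolding x0_def y0_def by (simp add: power2_eq_square algebra_simps)
  have im: "2 * x0 * y0 + 4 * (Re \<beta> * Im \<gamma> + Im \<beta> * Re \<gamma>) = 0"
    using arg_cong[OF sq, of Im] unfolding x0_def y0_def by (simp add: power2_eq_square algebra_simps)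
  have nm: "2 * (x0\<^sup>2 + y0\<^sup>2) - 4 * (cmod \<beta>)\<^sup>2 - 4 * (cmod \<gamma>)\<^sup>2 = m"
  proof -
    have "x0\<^sup>2 + y0\<^sup>2 = (cmod (cnj e * \<alpha>))\<^sup>2" unfolding x0_def y0_def by (rule cmod_power2[symmetric])
    also have "\<dots> = (cmod \<alpha>)\<^sup>2" using e(1) by (simp add: norm_mult)
    finally show ?thesis using e(1) unfolding m \<beta>_def \<gamma>_def by (simp add: norm_mult norm_divide power_divide)
  qed
  have A2: "x0\<^sup>2 - (cmod \<xi>)\<^sup>2 = A\<^sup>2"
  proof -
    have "(cmod \<xi>)\<^sup>2 = (cmod \<beta>)\<^sup>2 + (cmod \<gamma>)\<^sup>2 - 2 * (Re \<beta> * Re \<gamma> - Im \<beta> * Im \<gamma>)"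
      unfolding \<xi>_def cmod_power2 by (simp add: power2_eq_square algebra_simps)
    then show ?thesis using re nm unfolding e'(5) by argo
  qed
  have B2: "y0\<^sup>2 - (cmod \<eta>)\<^sup>2 = - B\<^sup>2"
  proof -
    have "(cmod \<eta>)\<^sup>2 = (cmod \<beta>)\<^sup>2 + (cmod \<gamma>)\<^sup>2 + 2 * (Re \<beta> * Re \<gamma> - Im \<beta> * Im \<gamma>)"
      unfolding \<eta>_def cmod_power2 by (simp add: power2_eq_square algebra_simps)
    then show ?thesis using re nm unfolding e'(6) by argo
  qed
  have orth: "x0 * y0 = Re (\<xi> * cnj \<eta>)"
    using im unfolding \<xi>_def \<eta>_def by (simp add: algebra_simps)
  have x0: "x0 > 0"
  proof -
    have "x0 \<ge> 0" by (simp add: x0_def e_def)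
    moreover have "x0\<^sup>2 > 0" using A2 e'(3) by (smt (verit) zero_less_power zero_le_power2)
    ultimately show ?thesis by (simp add: less_le)
  qed
  note lor = lorentz_image[OF e'(3) A2 e'(4) B2 orth x0]
  have gap: "branch_gap (b2 / 2) (of_real \<sigma> * e) A B z
      = Re w - A * cmod (Complex 1 (Im w / B))" if "w = cnj e * (of_real \<sigma> * (z - b2 / 2))" for \<sigma> z w
    unfolding that branch_gap_def by (simp add: mult_ac)
  show ?thesis
  proof (rule that[OF e e'(3-6)]; intro ballI allI impI)
    fix \<sigma> :: real and z assume s: "\<sigma> \<in> {1, - 1}" and bp: "block_point a b1 b2 b3 \<sigma> z"
    then obtain S \<Omega> where S: "0 \<le> S" "1 \<le> S\<^sup>2 - (cmod \<Omega>)\<^sup>2"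
      "of_real \<sigma> * (z - b2 / 2) = \<alpha> * of_real S + (b1 * cnj \<Omega> - b3 * \<Omega>) / 2"
      unfolding block_point_coordinates[OF s] \<alpha>_def[symmetric] by (elim exE conjE) (rule that)
    show "branch_gap (b2 / 2) (of_real \<sigma> * e) A B z \<ge> 0"
      using lor(1)[OF S(1,2)] unfolding gap[OF refl] S(3) coord by simp
  next
    fix \<sigma> :: real and z assume s: "\<sigma> \<in> {1, - 1}" and g: "branch_gap (b2 / 2) (of_real \<sigma> * e) A B z = 0"
    define w where "w = cnj e * (of_real \<sigma> * (z - b2 / 2))"
    have "Re w = A * cmod (Complex 1 (Im w / B))" using g unfolding gap[OF w_def] by simp
    from lor(2)[OF this] obtain S \<Omega> where S: "S > 0" "S\<^sup>2 - (cmod \<Omega>)\<^sup>2 = 1"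
      "Re w = x0 * S + Re (\<xi> * cnj \<Omega>)" "Im w = y0 * S + Re (\<eta> * cnj \<Omega>)"
      by (elim exE conjE) (rule that)
    have "w = Complex (Re w) (Im w)" by simp
    also have "\<dots> = cnj e * (\<alpha> * of_real S + (b1 * cnj \<Omega> - b3 * \<Omega>) / 2)" unfolding S(3,4) coord ..
    finally have "of_real \<sigma> * (z - b2 / 2) = \<alpha> * of_real S + (b1 * cnj \<Omega> - b3 * \<Omega>) / 2"
      unfolding w_def using e(1) by auto
    then show "block_point a b1 b2 b3 \<sigma> z"
      unfolding block_point_coordinates[OF s] \<alpha>_def[symmetric] using S(1,2)
      by (intro exI[of _ S] exI[of _ \<Omega>]) simp
  qed
qed

section \<open>Reduction to the two hyperbolas\<close>

lemma continuous_on_branch_gap: "continuous_on S (branch_gap c e A B)"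
proof -
  have "branch_gap c e A B = (\<lambda>z. Re (cnj e * (z - c)) - A * sqrt (1 + (Im (cnj e * (z - c)) / B)\<^sup>2))"
    by (simp add: branch_gap_def cmod_def fun_eq_iff)
  moreover have "continuous_on S (\<lambda>z. Re (cnj e * (z - c)) - A * sqrt (1 + (Im (cnj e * (z - c)) / B)\<^sup>2))"
    unfolding divide_inverse by (intro continuous_intros)
  ultimately show ?thesis by simp
qed

lemma branch_gap_zero_on_segment:
  assumes "branch_gap c e A B x \<ge> 0" "branch_gap c e A B y \<le> 0"
  obtains q where "q \<in> closed_segment x y" "branch_gap c e A B q = 0"
proof -
  have "continuous_on {0..1} (\<lambda>t. branch_gap c e A B (linepath x y t))"
    by (rule continuous_on_compose2[OF continuous_on_branch_gap[of UNIV]]) (auto intro: continuous_intros)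
  then have "\<exists>t. 0 \<le> t \<and> t \<le> 1 \<and> branch_gap c e A B (linepath x y t) = 0"
    using assms by (intro IVT2') (auto simp: linepath_def)
  then obtain t where t: "0 \<le> t" "t \<le> 1" "branch_gap c e A B (linepath x y t) = 0" by blast
  then have "linepath x y t \<in> closed_segment x y" by (intro linepath_in_path) auto
  then show ?thesis using t(3) that by blast
qed

text \<open>If the detour u, p, v were longer than the distance from u to v, the path x, u, v, y
  would be shorter than the segment from x to y.\<close>

lemma between_inner_points:
  fixes p x y u v :: complex
  assumes "p \<in> closed_segment x y" "u \<in> closed_segment x p" "v \<in> closed_segment y p"
  shows "p \<in> closed_segment u v"
proof -
  have 1: "dist x y = dist x p + dist p y" "dist x p = dist x u + dist u p" "dist y p = dist y v + dist v p"
    using assms unfolding between_mem_segment[symmetric] between by blast+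
  have "dist x y \<le> dist x u + dist u v + dist v y"
    using dist_triangle[of x y u] dist_triangle[of u y v] by linarith
  then have "dist u p + dist p v \<le> dist u v"
    using 1 by (simp add: dist_commute)
  moreover have "dist u v \<le> dist u p + dist p v" by (rule dist_triangle)
  ultimately show ?thesis unfolding between_mem_segment[symmetric] between by linarith
qed

text \<open>The chord through z perpendicular to the transverse axis: at abscissa X the branch has
  the ordinates B k and - B k, and z lies between them.\<close>

lemma branch_chord:
  assumes "cmod e = 1" "A > 0" "B > 0" "branch_gap c e A B z \<ge> 0"
  obtains z1 z2 where "branch_gap c e A B z1 = 0" "branch_gap c e A B z2 = 0" "z \<in> closed_segment z1 z2"
proof -
  obtain X Y where z: "z = c + e * Complex X Y" using unit_coordinates[OF assms(1)] .
  have X: "A * cmod (Complex 1 (Y / B)) \<le> X"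
    using assms(4) unfolding z branch_gap_line(1)[OF assms(1)] by simp
  have c2: "(cmod (Complex 1 y))\<^sup>2 = 1 + y\<^sup>2" for y by (simp add: cmod_power2)
  have cX: "cmod (Complex 1 (Y / B)) \<le> X / A" using X assms(2) by (simp add: field_simps)
  then have "(cmod (Complex 1 (Y / B)))\<^sup>2 \<le> (X / A)\<^sup>2" by (rule power_mono) simp
  then have Y: "(Y / B)\<^sup>2 \<le> (X / A)\<^sup>2 - 1" unfolding c2 by simp
  then have X1: "1 \<le> (X / A)\<^sup>2" using zero_le_power2[of "Y / B"] by linarith
  define k where "k = sqrt ((X / A)\<^sup>2 - 1)"
  have k: "k \<ge> 0" "k\<^sup>2 = (X / A)\<^sup>2 - 1"
    using X1 by (auto simp: k_def)
  have "\<bar>Y / B\<bar> \<le> k" unfolding k_def by (rule real_le_rsqrt) (unfold power2_abs, rule Y)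
  then have YB: "\<bar>Y\<bar> \<le> B * k" using assms(3) by (simp add: abs_divide field_simps)
  have X0: "X / A \<ge> 0" using cX norm_ge_zero order_trans by blast
  have edge: "branch_gap c e A B (c + e * Complex X (s * (B * k))) = 0" if "s \<in> {1, - 1}" for s
  proof -
    have "(cmod (Complex 1 (s * (B * k) / B)))\<^sup>2 = (X / A)\<^sup>2"
      unfolding c2 using that k(2) assms(3) by auto
    then have "cmod (Complex 1 (s * (B * k) / B)) = X / A"
      by (rule power2_eq_imp_eq) (use X0 in simp_all)
    then show ?thesis unfolding branch_gap_line(1)[OF assms(1)] using assms(2) by simp
  qed
  obtain t where t: "0 \<le> t" "t \<le> 1" "Y = (1 - t) * (1 * (B * k)) + t * (- 1 * (B * k))"
  proof (cases "B * k = 0")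
    \<comment> \<open>z is the vertex of the branch and the chord shrinks to a point.\<close>
    case True
    have "Y = 0" using YB unfolding True by simp
    then show ?thesis using that[of 0] unfolding True by simp
  next
    case False
    then have K: "B * k > 0" using assms(3) k(1) by (simp add: less_le)
    define t where "t = (B * k - Y) / (2 * (B * k))"
    have *: "(K - Y) / (2 * K) * K = (K - Y) / 2" "\<bar>Y\<bar> \<le> K \<Longrightarrow> 0 \<le> (K - Y) / (2 * K) \<and> (K - Y) / (2 * K) \<le> 1"
      if "K > 0" for K using that by (auto simp: field_simps abs_le_iff)
    have "t * (B * k) = (B * k - Y) / 2" unfolding t_def by (rule *(1)[OF K])
    then have "Y = (1 - t) * (1 * (B * k)) + t * (- 1 * (B * k))" by algebra
    moreover have "0 \<le> t" "t \<le> 1" using *(2)[OF K YB] unfolding t_def by blast+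
    ultimately show ?thesis by (intro that)
  qed
  have "Complex X Y = of_real (1 - t) * Complex X (1 * (B * k)) + of_real t * Complex X (- 1 * (B * k))"
    unfolding t(3) by (simp add: complex_eq_iff algebra_simps)
  then have "z = c + e * (of_real (1 - t) * Complex X (1 * (B * k)) + of_real t * Complex X (- 1 * (B * k)))"
    unfolding z by (simp only:)
  also have "\<dots> = of_real (1 - t) * (c + e * Complex X (1 * (B * k))) + of_real t * (c + e * Complex X (- 1 * (B * k)))"
    by (simp add: algebra_simps)
  finally have "z = of_real (1 - t) * (c + e * Complex X (1 * (B * k))) + of_real t * (c + e * Complex X (- 1 * (B * k)))" .
  then have "z \<in> closed_segment (c + e * Complex X (1 * (B * k))) (c + e * Complex X (- 1 * (B * k)))"
    unfolding in_segment scaleR_conv_of_real using t(1,2) by blast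
  then show ?thesis by (rule that[rotated 2]) (rule edge, simp)+
qed

lemma branch_gap_subset_hyp_locus:
  assumes "cmod e = 1" "D = e\<^sup>2 * of_real (cmod D)" "A > 0" "B > 0"
    and "A\<^sup>2 = (2 * cmod D + m) / 4" "B\<^sup>2 = (2 * cmod D - m) / 4"
    and "\<sigma> \<in> {1, - 1}" "branch_gap c (of_real \<sigma> * e) A B z = 0"
  shows "z \<in> hyp_locus c D m"
  unfolding hyp_locus_branches[OF assms(1-6)] using assms(7,8) by auto

text \<open>One sign is treated at a time: p is placed on a segment between two points of the
  branches belonging to its sign, which lie on \<open>H\<close> and are generated with that
  sign.\<close>

lemma jnum_range_subset_pseudo_convex_hull:
  fixes a b1 b2 b3
  assumes hp: "\<bar>M_plus a b1 b2 b3\<bar> < 2 * cmod (Delta_plus a b1 b2 b3)"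
    and hm: "\<bar>M_minus a b1 b2 b3\<bar> < 2 * cmod (Delta_minus a b1 b2 b3)"
  defines "H \<equiv> hyp_locus (b2 / 2) (Delta_plus a b1 b2 b3) (M_plus a b1 b2 b3)
    \<union> hyp_locus (- b2 / 2) (Delta_minus a b1 b2 b3) (M_minus a b1 b2 b3)"
  shows "jnum_range J4 (A4 a b1 b2 b3) \<subseteq> pseudo_convex_hull J4 (A4 a b1 b2 b3) H"
proof
  fix p assume "p \<in> jnum_range J4 (A4 a b1 b2 b3)"
  then obtain \<sigma> where s: "\<sigma> \<in> {1, - 1}" and fp: "form_point a b1 b2 b3 \<sigma> p"
    unfolding jnum_range_form_point by blast
  obtain e A B where g: "cmod e = 1" "Delta_plus a b1 b2 b3 = e\<^sup>2 * of_real (cmod (Delta_plus a b1 b2 b3))"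
    "A > 0" "B > 0"
    "A\<^sup>2 = (2 * cmod (Delta_plus a b1 b2 b3) + M_plus a b1 b2 b3) / 4"
    "B\<^sup>2 = (2 * cmod (Delta_plus a b1 b2 b3) - M_plus a b1 b2 b3) / 4"
    and bp_all: "\<forall>\<sigma>\<in>{1, - 1}. \<forall>z. block_point a b1 b2 b3 \<sigma> z \<longrightarrow> branch_gap (b2 / 2) (of_real \<sigma> * e) A B z \<ge> 0"
    "\<forall>\<sigma>\<in>{1, - 1}. \<forall>z. branch_gap (b2 / 2) (of_real \<sigma> * e) A B z = 0 \<longrightarrow> block_point a b1 b2 b3 \<sigma> z"
    by (rule block_region[OF hp])
  note bp = bp_all[rule_format]
  obtain e' A' B' where g': "cmod e' = 1" "Delta_minus a b1 b2 b3 = e'\<^sup>2 * of_real (cmod (Delta_minus a b1 b2 b3))"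
    "A' > 0" "B' > 0"
    "A'\<^sup>2 = (2 * cmod (Delta_minus a b1 b2 b3) + M_minus a b1 b2 b3) / 4"
    "B'\<^sup>2 = (2 * cmod (Delta_minus a b1 b2 b3) - M_minus a b1 b2 b3) / 4"
    and bp_all': "\<forall>\<sigma>\<in>{1, - 1}. \<forall>z. block_point a b1 (- b2) b3 \<sigma> z \<longrightarrow> branch_gap (- b2 / 2) (of_real \<sigma> * e') A' B' z \<ge> 0"
    "\<forall>\<sigma>\<in>{1, - 1}. \<forall>z. branch_gap (- b2 / 2) (of_real \<sigma> * e') A' B' z = 0 \<longrightarrow> block_point a b1 (- b2) b3 \<sigma> z"
    by (rule block_region[OF hm[unfolded M_minus_eq Delta_minus_eq], folded M_minus_eq Delta_minus_eq])
  note bp' = bp_all'[rule_format]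
  define G G' where "G = branch_gap (b2 / 2) (of_real \<sigma> * e) A B"
    and "G' = branch_gap (- b2 / 2) (of_real \<sigma> * e') A' B'"
  have unit: "cmod (of_real \<sigma> * e) = 1" "cmod (of_real \<sigma> * e') = 1"
    using s g(1) g'(1) by (auto simp: norm_mult)
  have on: "z \<in> H \<and> form_point a b1 b2 b3 \<sigma> z" if "G z = 0 \<or> G' z = 0" for z
    using that
  proof
    assume "G z = 0"
    then have "z \<in> hyp_locus (b2 / 2) (Delta_plus a b1 b2 b3) (M_plus a b1 b2 b3)" "block_point a b1 b2 b3 \<sigma> z"
      unfolding G_def by (rule branch_gap_subset_hyp_locus[OF g s], rule bp(2)[OF s])
    then show ?thesis unfolding H_def by (intro conjI UnI1 block_point_imp_form_point)
  next
    assume "G' z = 0"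
    then have "z \<in> hyp_locus (- b2 / 2) (Delta_minus a b1 b2 b3) (M_minus a b1 b2 b3)"
      and *: "block_point a b1 (- b2) b3 \<sigma> z"
      unfolding G'_def by (rule branch_gap_subset_hyp_locus[OF g' s], rule bp'(2)[OF s])
    moreover have "form_point a b1 b2 b3 \<sigma> z"
      using block_point_imp_form_point[OF *] unfolding form_point_uminus .
    ultimately show ?thesis unfolding H_def by (intro conjI UnI2)
  qed
  have "\<exists>z1 z2. (G z1 = 0 \<or> G' z1 = 0) \<and> (G z2 = 0 \<or> G' z2 = 0) \<and> p \<in> closed_segment z1 z2"
  proof -
    consider "G p \<ge> 0" | "G' p \<ge> 0" | "G p \<le> 0" "G' p \<le> 0" by linarith
    then show ?thesis
    proof cases
      case 1
      then show ?thesis unfolding G_def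
        by (rule branch_chord[OF unit(1) g(3,4)]) blast
    next
      case 2
      then show ?thesis unfolding G'_def
        by (rule branch_chord[OF unit(2) g'(3,4)]) blast
    next
      case 3
      \<comment> \<open>p is interior to neither region but lies between points of the two blocks.
        On the way from each of them to p the gap passes from nonnegative to nonpositive values, so
        a branch is met no later than at p.\<close>
      obtain p1 p2 where p: "block_point a b1 b2 b3 \<sigma> p1" "block_point a b1 (- b2) b3 \<sigma> p2"
        "p \<in> closed_segment p1 p2"
        by (rule form_point_between_blocks[OF fp s])
      obtain q1 where q1: "q1 \<in> closed_segment p1 p" "G q1 = 0"
        by (rule branch_gap_zero_on_segment[OF bp(1)[OF s p(1)], of p]) (use 3(1) in \<open>auto simp: G_def\<close>)
      obtain q2 where q2: "q2 \<in> closed_segment p2 p" "G' q2 = 0"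
        by (rule branch_gap_zero_on_segment[OF bp'(1)[OF s p(2)], of p]) (use 3(2) in \<open>auto simp: G'_def\<close>)
      have "p \<in> closed_segment q1 q2" by (rule between_inner_points[OF p(3) q1(1) q2(1)])
      then show ?thesis using q1(2) q2(2) by blast
    qed
  qed
  then obtain z1 z2 where z: "G z1 = 0 \<or> G' z1 = 0" "G z2 = 0 \<or> G' z2 = 0" "p \<in> closed_segment z1 z2"
    by blast
  show "p \<in> pseudo_convex_hull J4 (A4 a b1 b2 b3) H"
    unfolding pseudo_convex_hull_J4_A4
    using on[OF z(1)] on[OF z(2)] z(3) s by blast
qed

section \<open>The hyperbolic disc for \<open>b2 = 0\<close>\<close>

lemma branch_gap_concave:
  assumes "u \<ge> 0" "v \<ge> 0" "u + v = 1" "A \<ge> 0"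
  shows "u * branch_gap c e A B x + v * branch_gap c e A B y \<le> branch_gap c e A B (u *\<^sub>R x + v *\<^sub>R y)"
proof -
  define L where "L z = cnj e * (z - c)" for z
  have c: "u *\<^sub>R c + v *\<^sub>R c = c" using assms(3) by (simp flip: scaleR_add_left)
  have "u *\<^sub>R (x - c) + v *\<^sub>R (y - c) = u *\<^sub>R x + v *\<^sub>R y - (u *\<^sub>R c + v *\<^sub>R c)"
    by (simp add: scaleR_diff_right)
  then have "u *\<^sub>R x + v *\<^sub>R y - c = u *\<^sub>R (x - c) + v *\<^sub>R (y - c)" unfolding c by simp
  then have "L (u *\<^sub>R x + v *\<^sub>R y) = cnj e * (u *\<^sub>R (x - c) + v *\<^sub>R (y - c))"
    unfolding L_def by (rule arg_cong)
  also have "\<dots> = u *\<^sub>R L x + v *\<^sub>R L y" by (simp add: L_def scaleR_conv_of_real distrib_left)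
  finally have L: "L (u *\<^sub>R x + v *\<^sub>R y) = u *\<^sub>R L x + v *\<^sub>R L y" .
  \<comment> \<open>The first entry 1 is reproduced because u + v = 1. The gap is thus an affine
    function minus A times the norm of an affine map, hence concave.\<close>
  have "Complex 1 (Im (L (u *\<^sub>R x + v *\<^sub>R y)) / B)
      = u *\<^sub>R Complex 1 (Im (L x) / B) + v *\<^sub>R Complex 1 (Im (L y) / B)"
    unfolding L using assms(3) by (simp add: complex_eq_iff add_divide_distrib)
  then have "cmod (Complex 1 (Im (L (u *\<^sub>R x + v *\<^sub>R y)) / B))
      \<le> u * cmod (Complex 1 (Im (L x) / B)) + v * cmod (Complex 1 (Im (L y) / B))"
    using norm_triangle_ineq[of "u *\<^sub>R Complex 1 (Im (L x) / B)" "v *\<^sub>R Complex 1 (Im (L y) / B)"] assms(1,2)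
    by simp
  from mult_left_mono[OF this assms(4)] show ?thesis
    unfolding branch_gap_def L_def[symmetric] unfolding L by (simp add: algebra_simps)
qed

text \<open>The set where the gap is positive is convex and avoids both branches, so it lies in the
  component; a connected set leaving it would meet a zero of the gap.\<close>

lemma connected_component_branch:
  assumes "A > 0" and H: "H = {z. branch_gap c e A B z = 0} \<union> {z. branch_gap c (- e) A B z = 0}"
    and f: "branch_gap c e A B f > 0"
  shows "connected_component_set (- H) f = {z. branch_gap c e A B z > 0}"
proof (rule subset_antisym)
  have "convex {z. branch_gap c e A B z > 0}"
  proof (rule convexI)
    fix x y and u v :: real
    assume *: "x \<in> {z. branch_gap c e A B z > 0}" "y \<in> {z. branch_gap c e A B z > 0}" "0 \<le> u" "0 \<le> v" "u + v = 1"
    have "u * branch_gap c e A B x + v * branch_gap c e A B y > 0"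
    proof (cases "u = 0")
      case True
      then show ?thesis using * by simp
    next
      case False
      then show ?thesis using * by (intro add_pos_nonneg mult_pos_pos mult_nonneg_nonneg) auto
    qed
    then show "u *\<^sub>R x + v *\<^sub>R y \<in> {z. branch_gap c e A B z > 0}"
      using branch_gap_concave[OF *(3-5), of A c e B x y] assms(1) by simp
  qed
  \<comment> \<open>Where one gap is positive the opposite one is negative, so the region misses the
    other branch as well.\<close>
  moreover have gap: "branch_gap c e A B z + branch_gap c (- e) A B z \<le> 0" for z
  proof -
    have le: "branch_gap c e A B z \<le> Re (cnj e * (z - c))" for e
    proof -
      have "0 \<le> A * cmod w" for w using assms(1) by simp
      from this[of "Complex 1 (Im (cnj e * (z - c)) / B)"] show ?thesis
        unfolding branch_gap_def by linarith
    qed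
    have "Re (cnj (- e) * (z - c)) = - Re (cnj e * (z - c))" by simp
    then show ?thesis using le[of e] le[of "- e"] by linarith
  qed
  have "z \<notin> H" if "branch_gap c e A B z > 0" for z
    using that gap[of z] unfolding H by auto
  then have "{z. branch_gap c e A B z > 0} \<subseteq> - H"
    by blast
  ultimately show "{z. branch_gap c e A B z > 0} \<subseteq> connected_component_set (- H) f"
    using f by (intro connected_component_maximal convex_connected) auto
  show "connected_component_set (- H) f \<subseteq> {z. branch_gap c e A B z > 0}"
  proof
    fix y assume "y \<in> connected_component_set (- H) f"
    then obtain T where T: "connected T" "T \<subseteq> - H" "f \<in> T" "y \<in> T"
      by (auto simp: connected_component_def)
    have con: "connected (branch_gap c e A B ` T)"
      using T(1) continuous_on_branch_gap by (intro connected_continuous_image)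
    have "0 \<notin> branch_gap c e A B ` T" using T(2) unfolding H by auto
    then have "\<not> branch_gap c e A B y \<le> 0"
      using connectedD_interval[OF con imageI[OF T(4)] imageI[OF T(3)], of 0] f by auto
    then show "y \<in> {z. branch_gap c e A B z > 0}" by simp
  qed
qed

lemma hyp_region_disc:
  assumes h: "\<bar>m\<bar> < 2 * cmod D"
    and g: "cmod e = 1" "D = e\<^sup>2 * of_real (cmod D)" "A > 0" "B > 0"
    "A\<^sup>2 = (2 * cmod D + m) / 4" "B\<^sup>2 = (2 * cmod D - m) / 4"
  shows "nondegenerate_hyperbolic_disc (csqrt D) (- csqrt D) (sqrt (2 * cmod D + m)) (sqrt (2 * cmod D - m))
    {z. branch_gap 0 e A B z \<ge> 0 \<or> branch_gap 0 (- e) A B z \<ge> 0}"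
proof -
  define H where "H = hyp_locus 0 D m"
  have H1: "H = {z. branch_gap 0 e A B z = 0} \<union> {z. branch_gap 0 (- e) A B z = 0}"
    unfolding H_def by (rule hyp_locus_branches[OF g])
  then have H2: "H = {z. branch_gap 0 (- e) A B z = 0} \<union> {z. branch_gap 0 (- (- e)) A B z = 0}"
    by (simp add: Un_commute)
  \<comment> \<open>The foci are e r and - e r; the gap of the branch around each focus takes the
    value r - A > 0 there.\<close>
  define r where "r = sqrt (cmod D)"
  have "A\<^sup>2 < r\<^sup>2" using h g(5) by (simp add: r_def)
  then have Ar: "A < r" by (rule power2_less_imp_less) (simp add: r_def)
  have r2: "complex_of_real r * of_real r = of_real (cmod D)" by (simp add: r_def flip: of_real_mult)
  have "(csqrt D)\<^sup>2 = e\<^sup>2 * of_real (cmod D)" using g(2) by simp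
  also have "\<dots> = (e * of_real r)\<^sup>2" unfolding r2[symmetric] by algebra
  finally have "(csqrt D)\<^sup>2 = (e * of_real r)\<^sup>2" .
  \<comment> \<open>\<open>csqrt\<close> may pick either sign, so it stays open which focus it
    names; the union of the two components does not depend on this.\<close>
  then have cs: "csqrt D = e * of_real r \<or> csqrt D = - (e * of_real r)" by (simp only: power2_eq_iff)
  have er: "e * of_real r = 0 + e * Complex r 0" "- (e * of_real r) = 0 + e * Complex (- r) 0"
    by (simp_all add: complex_eq_iff)
  have one: "cmod (Complex 1 (0 / B)) = 1" by (simp add: cmod_def)
  have pos: "branch_gap 0 e A B (e * of_real r) > 0"
    unfolding er(1) branch_gap_line(1)[OF g(1)] one using Ar by simp
  have pos': "branch_gap 0 (- e) A B (- (e * of_real r)) > 0"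
    unfolding er(2) branch_gap_line(2)[OF g(1)] one using Ar by simp
  have comp: "connected_component_set (- H) (e * of_real r) = {z. branch_gap 0 e A B z > 0}"
    "connected_component_set (- H) (- (e * of_real r)) = {z. branch_gap 0 (- e) A B z > 0}"
    by (rule connected_component_branch[OF g(3) H1 pos], rule connected_component_branch[OF g(3) H2 pos'])
  have "connected_component_set (- H) (csqrt D) \<union> connected_component_set (- H) (- csqrt D)
      = {z. branch_gap 0 e A B z > 0} \<union> {z. branch_gap 0 (- e) A B z > 0}"
    using cs comp by (elim disjE) (simp_all add: Un_commute)
  moreover have "0 \<le> x \<or> 0 \<le> y \<longleftrightarrow> (x = 0 \<or> y = 0) \<or> 0 < x \<or> 0 < y" for x y :: real by auto
  then have "{z. branch_gap 0 e A B z \<ge> 0 \<or> branch_gap 0 (- e) A B z \<ge> 0}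
      = H \<union> ({z. branch_gap 0 e A B z > 0} \<union> {z. branch_gap 0 (- e) A B z > 0})"
    unfolding H1 by (simp only: set_eq_iff mem_Collect_eq Un_iff) simp
  ultimately have "{z. branch_gap 0 e A B z \<ge> 0 \<or> branch_gap 0 (- e) A B z \<ge> 0}
      = H \<union> connected_component_set (- H) (csqrt D) \<union> connected_component_set (- H) (- csqrt D)"
    by (simp only: Un_assoc)
  moreover have "nondegenerate_hyperbola (csqrt D) (- csqrt D) (sqrt (2 * cmod D + m)) (sqrt (2 * cmod D - m)) H"
    using nondegenerate_hyperbola_hyp_locus[OF h, of 0] by (simp add: H_def)
  ultimately show ?thesis unfolding nondegenerate_hyperbolic_disc_def by blast
qed

lemma jnum_range_disc:
  assumes "\<bar>M a b1 b3\<bar> < 2 * cmod (Delta a b1 b3)"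
  shows "nondegenerate_hyperbolic_disc (csqrt (Delta a b1 b3)) (- csqrt (Delta a b1 b3))
    (sqrt (2 * cmod (Delta a b1 b3) + M a b1 b3)) (sqrt (2 * cmod (Delta a b1 b3) - M a b1 b3))
    (jnum_range J4 (A4 a b1 0 b3))"
proof -
  have eq: "M_plus a b1 0 b3 = M a b1 b3" "Delta_plus a b1 0 b3 = Delta a b1 b3"
    by (simp_all add: M_plus_def Delta_plus_def)
  obtain e A B where g: "cmod e = 1" "Delta a b1 b3 = e\<^sup>2 * of_real (cmod (Delta a b1 b3))"
    "A > 0" "B > 0"
    "A\<^sup>2 = (2 * cmod (Delta a b1 b3) + M a b1 b3) / 4"
    "B\<^sup>2 = (2 * cmod (Delta a b1 b3) - M a b1 b3) / 4"
    and bp_all: "\<forall>\<sigma>\<in>{1, - 1}. \<forall>z. block_point a b1 0 b3 \<sigma> z \<longrightarrow> branch_gap (0 / 2) (of_real \<sigma> * e) A B z \<ge> 0"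
    "\<forall>\<sigma>\<in>{1, - 1}. \<forall>z. branch_gap (0 / 2) (of_real \<sigma> * e) A B z = 0 \<longrightarrow> block_point a b1 0 b3 \<sigma> z"
    by (rule block_region[of a b1 0 b3, unfolded eq, OF assms])
  note bp = bp_all[rule_format]
  have fp: "form_point a b1 0 b3 \<sigma> z \<longleftrightarrow> branch_gap 0 (of_real \<sigma> * e) A B z \<ge> 0" if s: "\<sigma> \<in> {1, - 1}" for \<sigma> z
  proof
    assume "form_point a b1 0 b3 \<sigma> z"
    then obtain P N \<Omega> d where f: "form_data P N \<Omega> d" "P - N = \<sigma>" "of_real \<sigma> * z = form_value a b1 0 b3 P N \<Omega> d"
      unfolding form_point_def by (elim exE conjE) (rule that)
    \<comment> \<open>For b2 = 0 the value does not depend on d, so d may be raised to N and the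
      point belongs to the block.\<close>
    have "form_data P N \<Omega> N" "of_real \<sigma> * z = form_value a b1 0 b3 P N \<Omega> N"
      using f(1,3) by (auto simp: form_data_def form_value_def)
    then have "block_point a b1 0 b3 \<sigma> z" unfolding block_point_def using f(2) by blast
    from bp(1)[OF s this] show "branch_gap 0 (of_real \<sigma> * e) A B z \<ge> 0" by simp
  next
    assume gp: "branch_gap 0 (of_real \<sigma> * e) A B z \<ge> 0"
    have "cmod (of_real \<sigma> * e) = 1" using s g(1) by (auto simp: norm_mult)
    then obtain z1 z2 where z: "branch_gap 0 (of_real \<sigma> * e) A B z1 = 0" "branch_gap 0 (of_real \<sigma> * e) A B z2 = 0"
      "z \<in> closed_segment z1 z2" by (rule branch_chord[OF _ g(3,4) gp])
    have "block_point a b1 0 b3 \<sigma> z1" "block_point a b1 0 b3 \<sigma> z2"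
      by (intro bp(2) s; simp add: z)+
    then show "form_point a b1 0 b3 \<sigma> z"
      by (intro form_point_convex[OF _ _ z(3)] block_point_imp_form_point)
  qed
  have fp1: "form_point a b1 0 b3 1 z \<longleftrightarrow> branch_gap 0 e A B z \<ge> 0"
    and fp2: "form_point a b1 0 b3 (- 1) z \<longleftrightarrow> branch_gap 0 (- e) A B z \<ge> 0" for z
    using fp[of 1 z] fp[of "- 1" z] by simp_all
  have "jnum_range J4 (A4 a b1 0 b3) = {z. branch_gap 0 e A B z \<ge> 0 \<or> branch_gap 0 (- e) A B z \<ge> 0}"
    by (simp only: set_eq_iff mem_Collect_eq jnum_range_form_point fp1 fp2) simp
  then show ?thesis using hyp_region_disc[OF assms g] by simp
qed

section \<open>Parameters giving the whole plane or a flat portion\<close>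

lemma jnum_range_UNIV_example: "jnum_range J4 (A4 0 1 2 1) = UNIV"
proof -
  have "z \<in> jnum_range J4 (A4 0 1 2 1)" for z
  proof -
    \<comment> \<open>For these parameters the value is - 2 d - \<i> Im \<Omega>: d and \<Omega>
      control the two coordinates separately, and a large N leaves room for both.\<close>
    define N where "N = \<bar>Re z\<bar> + \<bar>Im z\<bar>"
    define \<Omega> where "\<Omega> = - \<i> * of_real (Im z)"
    have "(Im z)\<^sup>2 \<le> N\<^sup>2" by (rule power2_le_iff_abs_le[THEN iffD2]) (simp_all add: N_def)
    moreover have N: "0 \<le> N" "\<bar>- Re z / 2\<bar> \<le> N" unfolding N_def by linarith+
    moreover have "4 * (N + 1) * N = 4 * N\<^sup>2 + 4 * N" by (simp add: power2_eq_square algebra_simps)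
    ultimately have "(Im z)\<^sup>2 \<le> 4 * (N + 1) * N" using zero_le_power2[of N] by linarith
    moreover have "(cmod \<Omega>)\<^sup>2 = (Im z)\<^sup>2" by (simp add: \<Omega>_def norm_mult)
    ultimately have "form_data (N + 1) N \<Omega> (- Re z / 2)"
      using N unfolding form_data_def by simp
    moreover have "of_real 1 * z = form_value 0 1 2 1 (N + 1) N \<Omega> (- Re z / 2)"
      by (simp add: form_value_def \<Omega>_def complex_eq_iff)
    ultimately have "form_point 0 1 2 1 1 z" unfolding form_point_def by (intro exI conjI) simp_all
    then show ?thesis unfolding jnum_range_form_point by blast
  qed
  then show ?thesis by blast
qed

text \<open>Here the real part of the value is P + N >= |P - N| = 1, so the range avoids an open
  vertical strip.\<close>

lemma jnum_range_flat_gap: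
  assumes "z \<in> jnum_range J4 (A4 1 1 (2 * \<i>) 1)"
  shows "\<bar>Re z\<bar> \<ge> 1"
proof -
  obtain \<sigma> where s: "\<sigma> = 1 \<or> \<sigma> = - 1" and fp: "form_point 1 1 (2 * \<i>) 1 \<sigma> z"
    using assms unfolding jnum_range_form_point by blast
  obtain P N \<Omega> d where f: "form_data P N \<Omega> d" "P - N = \<sigma>" "of_real \<sigma> * z = form_value 1 1 (2 * \<i>) 1 P N \<Omega> d"
    using fp unfolding form_point_def by (elim exE conjE) (rule that)
  have "Re (form_value 1 1 (2 * \<i>) 1 P N \<Omega> d) = P + N" by (simp add: form_value_def)
  then have "\<sigma> * Re z = P + N" unfolding f(3)[symmetric] by simp
  moreover have "0 \<le> P" "0 \<le> N" using f(1) unfolding form_data_def by blast+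
  ultimately show ?thesis using s f(2) by (elim disjE) simp_all
qed

text \<open>On the edge of the strip with \<sigma> = -1 the data are P = 0, N = 1, \<Omega> = 0,
  while d stays free in [-1, 1] and sweeps out a vertical segment.\<close>

lemma jnum_range_flat_member:
  assumes "Re z = - 1" "\<bar>Im z\<bar> \<le> 2"
  shows "z \<in> jnum_range J4 (A4 1 1 (2 * \<i>) 1)"
proof -
  have "form_data 0 1 0 (Im z / 2)" using assms(2) by (simp add: form_data_def)
  moreover have "of_real (- 1) * z = form_value 1 1 (2 * \<i>) 1 0 1 0 (Im z / 2)"
    using assms(1) by (simp add: form_value_def complex_eq_iff)
  ultimately have "form_point 1 1 (2 * \<i>) 1 (- 1) z"
    unfolding form_point_def by (intro exI conjI) (assumption, simp, assumption)
  then show ?thesis unfolding jnum_range_form_point by (rule disjI2)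
qed

lemma jnum_range_flat_example: "has_flat_portion (jnum_range J4 (A4 1 1 (2 * \<i>) 1))"
proof -
  let ?W = "jnum_range J4 (A4 1 1 (2 * \<i>) 1)"
  have "z \<in> frontier ?W" if zs: "z \<in> closed_segment (Complex (- 1) (- 2)) (Complex (- 1) 2)" for z
  proof -
    obtain t where t: "0 \<le> t" "t \<le> 1" "z = (1 - t) *\<^sub>R Complex (- 1) (- 2) + t *\<^sub>R Complex (- 1) 2"
      using zs unfolding in_segment by (elim exE conjE) (rule that)
    have z: "Re z = - 1" "Im z = 4 * t - 2" unfolding t(3) by (simp_all add: algebra_simps)
    have W: "z \<in> ?W" by (rule jnum_range_flat_member) (use z t(1,2) in simp_all)
    moreover have "z \<notin> interior ?W"
    proof
      assume "z \<in> interior ?W"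
      then obtain r where r: "r > 0" "ball z r \<subseteq> ?W"
        unfolding mem_interior by (elim exE conjE) (rule that)
      \<comment> \<open>A step of positive length at most 1 to the right of the line Re z = -1
        enters the strip.\<close>
      define \<delta> where "\<delta> = min (r / 2) 1"
      have d: "\<delta> > 0" "\<delta> < r" "\<delta> \<le> 1" using r(1) unfolding \<delta>_def by linarith+
      have "dist z (z + of_real \<delta>) = \<delta>" using d(1) by (simp add: dist_norm)
      then have "z + of_real \<delta> \<in> ball z r" unfolding mem_ball using d(2) by linarith
      then have "z + of_real \<delta> \<in> ?W" by (rule subsetD[OF r(2)])
      then have "\<bar>Re (z + of_real \<delta>)\<bar> \<ge> 1" by (rule jnum_range_flat_gap)
      then show False using d z(1) by simp
    qed
    ultimately show ?thesis
      unfolding frontier_def by (intro DiffI subsetD[OF closure_subset])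
  qed
  then have "closed_segment (Complex (- 1) (- 2)) (Complex (- 1) 2) \<subseteq> frontier ?W" by (rule subsetI)
  moreover have "Complex (- 1) (- 2) \<noteq> Complex (- 1) 2" by simp
  ultimately show ?thesis unfolding has_flat_portion_def by (intro disjI1 exI conjI)
qed

theorem theorem3p3:
  fixes a :: real and b1 b2 b3 :: complex
  shows
    "((\<exists>Hp Hm. nonconcentric_hyperbolas Hp Hm \<and>
         generating_curve J4 (A4 a b1 b2 b3) = Hp \<union> Hm) \<longleftrightarrow>
      b2 \<noteq> 0 \<and>
      \<bar>M_plus a b1 b2 b3\<bar> < 2 * cmod (Delta_plus a b1 b2 b3) \<and>
      \<bar>M_minus a b1 b2 b3\<bar> < 2 * cmod (Delta_minus a b1 b2 b3))
     \<and>
     (b2 \<noteq> 0 \<and>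
      \<bar>M_plus a b1 b2 b3\<bar> < 2 * cmod (Delta_plus a b1 b2 b3) \<and>
      \<bar>M_minus a b1 b2 b3\<bar> < 2 * cmod (Delta_minus a b1 b2 b3) \<longrightarrow>
      (\<exists>Hp Hm tp tm.
         nondegenerate_hyperbola
           (b2 / 2 + csqrt (Delta_plus a b1 b2 b3)) (b2 / 2 - csqrt (Delta_plus a b1 b2 b3))
           tp (sqrt (2 * cmod (Delta_plus a b1 b2 b3) - M_plus a b1 b2 b3)) Hp \<and>
         nondegenerate_hyperbola
           (- b2 / 2 + csqrt (Delta_minus a b1 b2 b3)) (- b2 / 2 - csqrt (Delta_minus a b1 b2 b3))
           tm (sqrt (2 * cmod (Delta_minus a b1 b2 b3) - M_minus a b1 b2 b3)) Hm \<and>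
         nonconcentric_hyperbolas Hp Hm \<and>
         generating_curve J4 (A4 a b1 b2 b3) = Hp \<union> Hm \<and>
         jnum_range J4 (A4 a b1 b2 b3) = pseudo_convex_hull J4 (A4 a b1 b2 b3) (Hp \<union> Hm)))
     \<and>
     (\<exists>a' b1' b2' b3'.
        (\<exists>Hp Hm. nonconcentric_hyperbolas Hp Hm \<and>
           generating_curve J4 (A4 a' b1' b2' b3') = Hp \<union> Hm) \<and>
        has_flat_portion (jnum_range J4 (A4 a' b1' b2' b3')))
     \<and>
     (\<exists>a' b1' b2' b3'.
        (\<exists>Hp Hm. nonconcentric_hyperbolas Hp Hm \<and>
           generating_curve J4 (A4 a' b1' b2' b3') = Hp \<union> Hm) \<and>
        jnum_range J4 (A4 a' b1' b2' b3') = UNIV)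
     \<and>
     (b2 = 0 \<and> \<bar>M a b1 b3\<bar> < 2 * cmod (Delta a b1 b3) \<longrightarrow>
      (\<exists>t. nondegenerate_hyperbolic_disc
             (csqrt (Delta a b1 b3)) (- csqrt (Delta a b1 b3))
             t (sqrt (2 * cmod (Delta a b1 b3) - M a b1 b3))
             (jnum_range J4 (A4 a b1 b2 b3))))"
  (is "?iff \<and> ?hull \<and> ?flat \<and> ?univ \<and> ?disc")
proof (intro conjI)
  show ?iff by (rule generating_curve_iff)
  show ?hull
  proof (intro impI, elim conjE)
    assume b2: "b2 \<noteq> 0" and hp: "\<bar>M_plus a b1 b2 b3\<bar> < 2 * cmod (Delta_plus a b1 b2 b3)"
      and hm: "\<bar>M_minus a b1 b2 b3\<bar> < 2 * cmod (Delta_minus a b1 b2 b3)"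
    have "jnum_range J4 (A4 a b1 b2 b3) = pseudo_convex_hull J4 (A4 a b1 b2 b3)
       (hyp_locus (b2 / 2) (Delta_plus a b1 b2 b3) (M_plus a b1 b2 b3)
        \<union> hyp_locus (- b2 / 2) (Delta_minus a b1 b2 b3) (M_minus a b1 b2 b3))"
      by (rule subset_antisym[OF jnum_range_subset_pseudo_convex_hull[OF hp hm]
            pseudo_convex_hull_subset_jnum_range])
    then show "\<exists>Hp Hm tp tm.
         nondegenerate_hyperbola
           (b2 / 2 + csqrt (Delta_plus a b1 b2 b3)) (b2 / 2 - csqrt (Delta_plus a b1 b2 b3))
           tp (sqrt (2 * cmod (Delta_plus a b1 b2 b3) - M_plus a b1 b2 b3)) Hp \<and>
         nondegenerate_hyperbola
           (- b2 / 2 + csqrt (Delta_minus a b1 b2 b3)) (- b2 / 2 - csqrt (Delta_minus a b1 b2 b3))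
           tm (sqrt (2 * cmod (Delta_minus a b1 b2 b3) - M_minus a b1 b2 b3)) Hm \<and>
         nonconcentric_hyperbolas Hp Hm \<and>
         generating_curve J4 (A4 a b1 b2 b3) = Hp \<union> Hm \<and>
         jnum_range J4 (A4 a b1 b2 b3) = pseudo_convex_hull J4 (A4 a b1 b2 b3) (Hp \<union> Hm)"
      by (intro exI conjI) (rule nondegenerate_hyperbola_hyp_locus[OF hp]
          nondegenerate_hyperbola_hyp_locus[OF hm] nonconcentric_hyp_locus[OF b2 hp hm]
          generating_curve_hyperbolas[OF hp hm] | assumption)+
  qed
  \<comment> \<open>In the flat example \<open>Delta_plus\<close> and \<open>Delta_minus\<close> are
    1 - 2\<i> and 1 + 2\<i>, of modulus sqrt 5, while \<open>M_plus\<close> and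
    \<open>M_minus\<close> are 2.\<close>
  have "4 < 2 * cmod (1 - 2 * \<i>)" "4 < 2 * cmod (1 + 2 * \<i>)"
    by (simp_all add: cmod_def real_less_rsqrt)
  then have "\<bar>M_plus 1 1 (2 * \<i>) 1\<bar> < 2 * cmod (Delta_plus 1 1 (2 * \<i>) 1)"
    "\<bar>M_minus 1 1 (2 * \<i>) 1\<bar> < 2 * cmod (Delta_minus 1 1 (2 * \<i>) 1)"
    by (simp_all add: M_plus_def M_minus_def M_def Delta_plus_def Delta_minus_def Delta_def
        norm_mult power_mult_distrib)
  then show ?flat
    using generating_curve_iff[of 1 1 "2 * \<i>" 1] jnum_range_flat_example
    by (intro exI[of _ 1] exI[of _ "2 * \<i>"]) simp
  \<comment> \<open>Here \<open>M_plus\<close> and \<open>M_minus\<close> vanish, and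
    \<open>Delta_plus\<close> and \<open>Delta_minus\<close> are both 2.\<close>
  have "\<bar>M_plus 0 1 2 1\<bar> < 2 * cmod (Delta_plus 0 1 2 1)"
    "\<bar>M_minus 0 1 2 1\<bar> < 2 * cmod (Delta_minus 0 1 2 1)"
    by (simp_all add: M_plus_def M_minus_def M_def Delta_plus_def Delta_minus_def Delta_def)
  then show ?univ
    using generating_curve_iff[of 0 1 2 1] jnum_range_UNIV_example
    by (intro exI[of _ 0] exI[of _ 1] exI[of _ 2] exI[of _ 1]) simp
  show ?disc using jnum_range_disc by blast
qed

end
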